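(* For every integer $v \ge 4$ there are at least $\lfloor v^{1/6} \rfloor !$ pairwise non-isomorphic strongly regular graphs of order (number of vertices) at most $v$ satisfying the $4$-vertex condition.
   Context: Graphs are finite, simple and undirected. A graph of order $v$ is strongly regular with parameters $(v,k,\lambda,\mu)$ if it is neither complete nor edgeless, each vertex has degree $k$, any two adjacent vertices have exactly $\lambda$ common neighbors, and any two distinct non-adjacent vertices have exactly $\mu$ common neighbors. A graph $\Gamma$ satisfies the $t$-vertex condition if, for all triples $(T,x_0,y_0)$ consisting of a $t$-vertex graph $T$ together with two distinct distinguished vertices $x_0,y_0$ of $T$, and all pairs of distinct vertices $x,y$ of $\Gamma$, the number of isomorphic copies of $T$ in $\Gamma$ (as induced subgraphs), where the isomorphism maps $x_0$ to $x$ and $y_0$ to $y$, does not depend on the choice of the pair $x,y$ but only on whether $x,y$ are adjacent or nonadjacent. *)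

theory Defs
  imports Complex_Main "Graph_Theory.Graph_Theory"
begin

text \<open>
  Finite simple undirected graphs are rendered by \<^locale>\<open>pair_graph\<close>: a finite vertex set together
  with a symmetric irreflexive set of ordered pairs of vertices. An undirected edge thus
  corresponds to two opposite arcs, and \<^const>\<open>out_degree\<close> is the degree.
\<close>

definition common_neighbours :: "'a pair_pre_digraph \<Rightarrow> 'a \<Rightarrow> 'a \<Rightarrow> 'a set" where
  "common_neighbours G x y = {z \<in> pverts G. (x, z) \<in> parcs G \<and> (y, z) \<in> parcs G}"

definition strongly_regular ::
    "'a pair_pre_digraph \<Rightarrow> nat \<Rightarrow> nat \<Rightarrow> nat \<Rightarrow> nat \<Rightarrow> bool" where
  "strongly_regular G v k l m \<longleftrightarrow>
     pair_graph G \<and> card (pverts G) = v \<and>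
     \<not> complete_digraph v (with_proj G) \<and> parcs G \<noteq> {} \<and>
     (\<forall>x \<in> pverts G. out_degree (with_proj G) x = k) \<and>
     (\<forall>x \<in> pverts G. \<forall>y \<in> pverts G. (x, y) \<in> parcs G \<longrightarrow>
        card (common_neighbours G x y) = l) \<and>
     (\<forall>x \<in> pverts G. \<forall>y \<in> pverts G. x \<noteq> y \<and> (x, y) \<notin> parcs G \<longrightarrow>
        card (common_neighbours G x y) = m)"

text \<open>
  Copies are subgraphs, not embeddings: several isomorphisms from \<open>T\<close> onto the same induced
  subgraph sending \<open>x\<^sub>0\<close> to \<open>x\<close> and \<open>y\<^sub>0\<close> to \<open>y\<close> count once.
\<close>

definition induced_copies ::
    "'b pair_pre_digraph \<Rightarrow> 'b \<Rightarrow> 'b \<Rightarrow> 'a pair_pre_digraph \<Rightarrow> 'a \<Rightarrow> 'a \<Rightarrow>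
     ('a, 'a \<times> 'a) pre_digraph set" where
  "induced_copies T x\<^sub>0 y\<^sub>0 G x y =
     {H. induced_subgraph H (with_proj G) \<and>
         (\<exists>f. pre_digraph.digraph_isomorphism (with_proj T) f \<and> H = app_iso f (with_proj T) \<and>
              iso_verts f x\<^sub>0 = x \<and> iso_verts f y\<^sub>0 = y)}"

text \<open>
  The test graph \<open>T\<close> ranges over graphs with vertices in \<^typ>\<open>nat\<close>; this is no restriction, as every
  finite graph is isomorphic to such a graph.
\<close>

definition vertex_condition :: "nat \<Rightarrow> 'a pair_pre_digraph \<Rightarrow> bool" where
  "vertex_condition t G \<longleftrightarrow>
     (\<forall>(T :: nat pair_pre_digraph) x\<^sub>0 y\<^sub>0.
        pair_graph T \<and> card (pverts T) = t \<and> x\<^sub>0 \<in> pverts T \<and> y\<^sub>0 \<in> pverts T \<and> x\<^sub>0 \<noteq> y\<^sub>0 \<longrightarrow>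
        (\<forall>x \<in> pverts G. \<forall>y \<in> pverts G. \<forall>x' \<in> pverts G. \<forall>y' \<in> pverts G.
           x \<noteq> y \<and> x' \<noteq> y' \<and> ((x, y) \<in> parcs G \<longleftrightarrow> (x', y') \<in> parcs G) \<longrightarrow>
           card (induced_copies T x\<^sub>0 y\<^sub>0 G x y) = card (induced_copies T x\<^sub>0 y\<^sub>0 G x' y')))"

end

theory Submission
  imports Defs "HOL-Combinatorics.Permutations"
begin

text \<open>
  A strongly regular graph satisfies the 4-vertex condition as soon as the number of edges in the
  common neighbourhood of two vertices depends only on their adjacency (Hestenes and Higman).

  Let \<open>M\<close> be a symmetric, normalised Hadamard matrix of order \<open>N\<close> with constant diagonal \<open>1\<close>. The
  graph on the indices other than that of the all-one row, with adjacency \<open>M x y = -1\<close>, is strongly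
  regular, and the above edge count is governed by \<open>u\<^sup>T M u\<close>, where \<open>u\<close> is the product of the rows
  \<open>x\<close> and \<open>y\<close>. If this value is always \<open>N\<close>, the 4-vertex condition holds. This applies to the sign
  matrix of the symplectic form on \<open>F\<^sub>2\<^sup>d \<times> F\<^sub>2\<^sup>d\<close>, and it survives twisting the adjacencies between a
  Lagrangian subspace and its complement by any permutation \<open>\<phi>\<close> of the nonzero vectors of \<open>F\<^sub>2\<^sup>d\<close>.

  An isomorphism onto a fixed graph determines \<open>\<phi>\<close> by its values on \<open>3 d\<close> vertices, so that the
  \<open>(2\<^sup>d - 1)!\<close> permutations give at least \<open>(2\<^sup>d - 1)! / N\<^sup>3\<^sup>d\<close> isomorphism classes, where \<open>N = 4\<^sup>d\<close>. This suffices
  once \<open>d \<ge> 7\<close>. For \<open>v < 9\<^sup>6\<close> there are enough perfect matchings, which are strongly regular with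
  \<open>\<mu> = 0\<close>.
\<close>

section \<open>The 4-vertex condition for strongly regular graphs\<close>

lemma pair_graph_iff:
  "pair_graph G \<longleftrightarrow> finite (pverts G) \<and> parcs G \<subseteq> pverts G \<times> pverts G \<and>
     sym (parcs G) \<and> irrefl (parcs G)" (is "_ \<longleftrightarrow> ?R")
proof
  assume "pair_graph G"
  then interpret pair_graph G .
  show ?R
  proof (intro conjI)
    show "parcs G \<subseteq> pverts G \<times> pverts G"
      using in_arcsD1 in_arcsD2 by auto
    show "irrefl (parcs G)"
      by (blast intro: irreflI dest: no_loops')
  qed (use pair_finite_verts arcs_symmetric in \<open>auto simp: sym_def\<close>)
next
  assume R: ?R
  then have "finite (parcs G)"
    by (meson finite_SigmaI finite_subset)
  with R show "pair_graph G"
    by unfold_locales (auto simp: symmetric_def irrefl_def)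
qed

text \<open>An isomorphism of digraphs carries separate maps for vertices and arcs. Once the
  incidence maps of the target are the projections \<open>fst\<close> and \<open>snd\<close>, the
  arc map is forced to send \<open>(u, v)\<close> to the pair of the vertex images, so arcs are
  preserved and reflected by the vertex map alone.\<close>

lemma digraph_isomorphism_with_proj:
  assumes T: "pair_graph T" and f: "pre_digraph.digraph_isomorphism (with_proj T) f"
    and comp: "iso_tail f = fst" "iso_head f = snd"
    and uv: "u \<in> pverts T" "v \<in> pverts T"
  shows "(iso_verts f u, iso_verts f v) \<in> iso_arcs f ` parcs T \<longleftrightarrow> (u, v) \<in> parcs T"
proof -
  have inj: "inj_on (iso_verts f) (pverts T)"
    using f by (simp add: pre_digraph.digraph_isomorphism_def)
  have arc: "iso_arcs f (u, v) = (iso_verts f u, iso_verts f v)" if "(u, v) \<in> parcs T" for u v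
  proof -
    have "iso_verts f u = iso_tail f (iso_arcs f (u, v))" "iso_verts f v = iso_head f (iso_arcs f (u, v))"
      using f that by (force simp: pre_digraph.digraph_isomorphism_def)+
    then show ?thesis
      by (simp add: comp prod_eq_iff)
  qed
  show ?thesis
  proof
    assume "(iso_verts f u, iso_verts f v) \<in> iso_arcs f ` parcs T"
    then obtain u' v' where uv': "(u', v') \<in> parcs T" "iso_verts f u = iso_verts f u'"
      "iso_verts f v = iso_verts f v'"
      using arc by force
    moreover have "u' \<in> pverts T" "v' \<in> pverts T"
      using T uv'(1) by (auto simp: pair_graph_iff)
    ultimately show "(u, v) \<in> parcs T"
      using inj_onD[OF inj uv'(2)] inj_onD[OF inj uv'(3)] uv by simp
  next
    assume "(u, v) \<in> parcs T"
    then show "(iso_verts f u, iso_verts f v) \<in> iso_arcs f ` parcs T"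
      using arc by force
  qed
qed

lemma digraph_iso_with_projD:
  assumes G: "pair_graph G" and iso: "digraph_iso (with_proj G) (with_proj H)"
  obtains g where "bij_betw g (pverts G) (pverts H)"
    and "\<And>u v. u \<in> pverts G \<Longrightarrow> v \<in> pverts G \<Longrightarrow> (g u, g v) \<in> parcs H \<longleftrightarrow> (u, v) \<in> parcs G"
proof -
  obtain f where f: "pre_digraph.digraph_isomorphism (with_proj G) f"
    and H: "with_proj H = app_iso f (with_proj G)"
    using iso by (auto simp: digraph_iso_def)
  have "inj_on (iso_verts f) (pverts G)"
    using f by (simp add: pre_digraph.digraph_isomorphism_def)
  moreover have "pverts H = iso_verts f ` pverts G" "parcs H = iso_arcs f ` parcs G"
    "iso_tail f = fst" "iso_head f = snd"
    using arg_cong[OF H, of verts] arg_cong[OF H, of arcs] arg_cong[OF H, of tail]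
      arg_cong[OF H, of head] by simp_all
  ultimately show ?thesis
    using digraph_isomorphism_with_proj[OF G f] by (intro that[of "iso_verts f"]) (auto simp: bij_betw_def)
qed

lemma digraph_iso_refl:
  assumes "wf_digraph G"
  shows "digraph_iso G G"
  unfolding digraph_iso_def
proof (intro exI conjI)
  let ?f = "\<lparr>iso_verts = id, iso_arcs = id, iso_head = head G, iso_tail = tail G\<rparr>"
  show "pre_digraph.digraph_isomorphism G ?f"
    using assms by (simp add: pre_digraph.digraph_isomorphism_def)
  show "G = app_iso ?f G"
    by (simp add: app_iso_def)
qed

text \<open>A copy is the subgraph induced on the image of an embedding. Being a subgraph of
  \<open>with_proj G\<close> makes the incidence maps of the copy projections, so only the vertex
  map matters; conversely \<open>map_prod g g\<close> turns an embedding \<open>g\<close> into an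
  isomorphism.\<close>

lemma induced_copies_eq_image:
  assumes T: "pair_graph T" and G: "pair_graph G" and x0: "x\<^sub>0 \<in> pverts T" and y0: "y\<^sub>0 \<in> pverts T"
  shows "induced_copies T x\<^sub>0 y\<^sub>0 G x y =
    (\<lambda>g. induce_subgraph (with_proj G) (g ` pverts T)) `
      {g. inj_on g (pverts T) \<and> g ` pverts T \<subseteq> pverts G \<and> g x\<^sub>0 = x \<and> g y\<^sub>0 = y \<and>
          (\<forall>u\<in>pverts T. \<forall>v\<in>pverts T. (g u, g v) \<in> parcs G \<longleftrightarrow> (u, v) \<in> parcs T)}"
    (is "?L = ?R")
proof (intro set_eqI iffI)
  fix H assume "H \<in> ?L"
  then obtain f where sub: "induced_subgraph H (with_proj G)"
    and f: "pre_digraph.digraph_isomorphism (with_proj T) f" and H: "H = app_iso f (with_proj T)"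
    and xy: "iso_verts f x\<^sub>0 = x" "iso_verts f y\<^sub>0 = y"
    by (auto simp: induced_copies_def)
  define g where "g = iso_verts f"
  have inj: "inj_on g (pverts T)"
    using f by (simp add: pre_digraph.digraph_isomorphism_def g_def)
  have comp: "iso_tail f = fst" "iso_head f = snd"
    using sub by (auto simp: H induced_subgraph_def subgraph_def compatible_def)
  have vs: "g ` pverts T \<subseteq> pverts G"
    using sub by (auto simp: H induced_subgraph_def subgraph_def g_def)
  have arcsH: "iso_arcs f ` parcs T = {e \<in> parcs G. fst e \<in> g ` pverts T \<and> snd e \<in> g ` pverts T}"
    using sub by (simp add: H induced_subgraph_def g_def)
  have pres: "(g u, g v) \<in> parcs G \<longleftrightarrow> (u, v) \<in> parcs T"
    if "u \<in> pverts T" "v \<in> pverts T" for u v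
    using digraph_isomorphism_with_proj[OF T f comp that] that by (simp add: arcsH flip: g_def)
  have "H = induce_subgraph (with_proj G) (g ` pverts T)"
    unfolding H induce_subgraph_def app_iso_def
    using arcsH comp by (simp add: g_def)
  then show "H \<in> ?R"
    by (rule image_eqI[where x = g]) (use inj vs xy pres in \<open>simp add: g_def\<close>)
next
  fix H assume "H \<in> ?R"
  then obtain g where inj: "inj_on g (pverts T)" and vs: "g ` pverts T \<subseteq> pverts G"
    and xy: "g x\<^sub>0 = x" "g y\<^sub>0 = y"
    and pres: "\<And>u v. u \<in> pverts T \<Longrightarrow> v \<in> pverts T \<Longrightarrow> (g u, g v) \<in> parcs G \<longleftrightarrow> (u, v) \<in> parcs T"
    and H: "H = induce_subgraph (with_proj G) (g ` pverts T)"
    by blast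
  define f where "f = \<lparr>iso_verts = g, iso_arcs = map_prod g g, iso_head = snd, iso_tail = fst\<rparr>"
  have TT: "parcs T \<subseteq> pverts T \<times> pverts T"
    using T by (simp add: pair_graph_iff)
  have "wf_digraph (with_proj T)"
    using T by (auto simp: wf_digraph_def pair_graph_iff)
  moreover have "inj_on (map_prod g g) (parcs T)"
    by (rule inj_on_subset[OF map_prod_inj_on[OF inj inj] TT])
  ultimately have iso: "pre_digraph.digraph_isomorphism (with_proj T) f"
    using inj by (simp add: pre_digraph.digraph_isomorphism_def f_def)
  have "map_prod g g ` parcs T = {e \<in> parcs G. fst e \<in> g ` pverts T \<and> snd e \<in> g ` pverts T}"
  proof (intro equalityI subsetI)
    fix e assume "e \<in> map_prod g g ` parcs T"
    then show "e \<in> {e \<in> parcs G. fst e \<in> g ` pverts T \<and> snd e \<in> g ` pverts T}"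
      using TT pres by auto
  next
    fix e assume "e \<in> {e \<in> parcs G. fst e \<in> g ` pverts T \<and> snd e \<in> g ` pverts T}"
    then obtain u w where uw: "u \<in> pverts T" "w \<in> pverts T" "e = (g u, g w)" "e \<in> parcs G"
      by (cases e) auto
    then have "(u, w) \<in> parcs T"
      using pres by simp
    then show "e \<in> map_prod g g ` parcs T"
      using uw(3) by force
  qed
  then have Happ: "H = app_iso f (with_proj T)"
    by (simp add: H induce_subgraph_def app_iso_def f_def)
  have "wf_digraph (with_proj G)"
    using G by (auto simp: wf_digraph_def pair_graph_iff)
  then have "induced_subgraph H (with_proj G)"
    using vs by (auto simp: H induce_subgraph_def induced_subgraph_def subgraph_def
        compatible_def wf_digraph_def)
  moreover have "iso_verts f x\<^sub>0 = x" "iso_verts f y\<^sub>0 = y"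
    by (simp_all add: f_def xy)
  ultimately show "H \<in> ?L"
    using iso Happ unfolding induced_copies_def by blast
qed

text \<open>Two of the four vertices of \<open>T\<close> have prescribed images, so an embedding is
  an ordered pair \<open>(z, w)\<close> of images of the other two. The pairs are taken through an
  image because \<open>(z, w)\<close> and \<open>(w, z)\<close> may give the same copy.\<close>

lemma induced_copies_four:
  assumes T: "pair_graph T" and G: "pair_graph G"
    and VT: "pverts T = {x\<^sub>0, y\<^sub>0, z\<^sub>0, w\<^sub>0}" and dist: "distinct [x\<^sub>0, y\<^sub>0, z\<^sub>0, w\<^sub>0]"
    and x: "x \<in> pverts G" and y: "y \<in> pverts G" and xy: "x \<noteq> y"
  shows "induced_copies T x\<^sub>0 y\<^sub>0 G x y =
    (\<lambda>(z, w). induce_subgraph (with_proj G) {x, y, z, w}) `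
      {(z, w). z \<in> pverts G \<and> w \<in> pverts G \<and> distinct [x, y, z, w] \<and>
        ((x, y) \<in> parcs G \<longleftrightarrow> (x\<^sub>0, y\<^sub>0) \<in> parcs T) \<and>
        ((x, z) \<in> parcs G \<longleftrightarrow> (x\<^sub>0, z\<^sub>0) \<in> parcs T) \<and>
        ((y, z) \<in> parcs G \<longleftrightarrow> (y\<^sub>0, z\<^sub>0) \<in> parcs T) \<and>
        ((x, w) \<in> parcs G \<longleftrightarrow> (x\<^sub>0, w\<^sub>0) \<in> parcs T) \<and>
        ((y, w) \<in> parcs G \<longleftrightarrow> (y\<^sub>0, w\<^sub>0) \<in> parcs T) \<and>
        ((z, w) \<in> parcs G \<longleftrightarrow> (z\<^sub>0, w\<^sub>0) \<in> parcs T)}"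
    (is "_ = ?I ` ?P")
proof -
  have symT: "(u, v) \<in> parcs T \<longleftrightarrow> (v, u) \<in> parcs T" and irrT: "(u, u) \<notin> parcs T" for u v
    using T by (auto simp: pair_graph_iff sym_def irrefl_def)
  have symG: "(u, v) \<in> parcs G \<longleftrightarrow> (v, u) \<in> parcs G" and irrG: "(u, u) \<notin> parcs G" for u v
    using G by (auto simp: pair_graph_iff sym_def irrefl_def)
  let ?E = "{g. inj_on g (pverts T) \<and> g ` pverts T \<subseteq> pverts G \<and> g x\<^sub>0 = x \<and> g y\<^sub>0 = y \<and>
          (\<forall>u\<in>pverts T. \<forall>v\<in>pverts T. (g u, g v) \<in> parcs G \<longleftrightarrow> (u, v) \<in> parcs T)}"
  have "induced_copies T x\<^sub>0 y\<^sub>0 G x y = (\<lambda>g. induce_subgraph (with_proj G) (g ` pverts T)) ` ?E"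
    by (rule induced_copies_eq_image[OF T G]) (simp_all add: VT)
  also have "\<dots> = ?I ` ?P"
  proof (intro set_eqI iffI)
    fix H assume "H \<in> (\<lambda>g. induce_subgraph (with_proj G) (g ` pverts T)) ` ?E"
    then obtain g where g: "inj_on g (pverts T)" "g ` pverts T \<subseteq> pverts G" "g x\<^sub>0 = x" "g y\<^sub>0 = y"
      and pres: "\<And>u v. u \<in> pverts T \<Longrightarrow> v \<in> pverts T \<Longrightarrow> (g u, g v) \<in> parcs G \<longleftrightarrow> (u, v) \<in> parcs T"
      and H: "H = induce_subgraph (with_proj G) (g ` pverts T)"
      by blast
    have "distinct (map g [x\<^sub>0, y\<^sub>0, z\<^sub>0, w\<^sub>0])"
      using dist g(1) by (subst distinct_map) (simp add: VT)
    then have "(g z\<^sub>0, g w\<^sub>0) \<in> ?P"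
      using g(2) pres[of x\<^sub>0 y\<^sub>0] pres[of x\<^sub>0 z\<^sub>0] pres[of x\<^sub>0 w\<^sub>0] pres[of y\<^sub>0 z\<^sub>0] pres[of y\<^sub>0 w\<^sub>0]
        pres[of z\<^sub>0 w\<^sub>0]
      by (simp add: VT g(3,4))
    moreover have "H = ?I (g z\<^sub>0, g w\<^sub>0)"
      by (simp add: H VT g(3,4))
    ultimately show "H \<in> ?I ` ?P"
      by (rule rev_image_eqI)
  next
    fix H assume "H \<in> ?I ` ?P"
    then obtain z w where zw: "(z, w) \<in> ?P" and H: "H = ?I (z, w)"
      by (metis (no_types, lifting) imageE prod.collapse)
    define g where "g = (\<lambda>u. if u = x\<^sub>0 then x else if u = y\<^sub>0 then y else if u = z\<^sub>0 then z else w)"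
    have g: "g x\<^sub>0 = x" "g y\<^sub>0 = y" "g z\<^sub>0 = z" "g w\<^sub>0 = w"
      using dist by (auto simp: g_def)
    have "distinct (map g [x\<^sub>0, y\<^sub>0, z\<^sub>0, w\<^sub>0])"
      using zw by (simp add: g)
    then have "inj_on g (set [x\<^sub>0, y\<^sub>0, z\<^sub>0, w\<^sub>0])"
      using distinct_map by blast
    then have "inj_on g (pverts T)"
      by (simp only: VT list.set)
    moreover have "g ` pverts T \<subseteq> pverts G"
      using zw x y by (simp add: VT g)
    moreover have "(g u, g v) \<in> parcs G \<longleftrightarrow> (u, v) \<in> parcs T" if "u \<in> pverts T" "v \<in> pverts T" for u v
    proof -
      have uv: "u \<in> {x\<^sub>0, y\<^sub>0, z\<^sub>0, w\<^sub>0}" "v \<in> {x\<^sub>0, y\<^sub>0, z\<^sub>0, w\<^sub>0}"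
        using that by (simp_all only: VT)
      have pres: "(x, y) \<in> parcs G \<longleftrightarrow> (x\<^sub>0, y\<^sub>0) \<in> parcs T" "(x, z) \<in> parcs G \<longleftrightarrow> (x\<^sub>0, z\<^sub>0) \<in> parcs T"
        "(y, z) \<in> parcs G \<longleftrightarrow> (y\<^sub>0, z\<^sub>0) \<in> parcs T" "(x, w) \<in> parcs G \<longleftrightarrow> (x\<^sub>0, w\<^sub>0) \<in> parcs T"
        "(y, w) \<in> parcs G \<longleftrightarrow> (y\<^sub>0, w\<^sub>0) \<in> parcs T" "(z, w) \<in> parcs G \<longleftrightarrow> (z\<^sub>0, w\<^sub>0) \<in> parcs T"
        using zw by simp_all
      note syms = symT[of y\<^sub>0 x\<^sub>0] symT[of z\<^sub>0 x\<^sub>0] symT[of z\<^sub>0 y\<^sub>0] symT[of w\<^sub>0 x\<^sub>0] symT[of w\<^sub>0 y\<^sub>0] symT[of w\<^sub>0 z\<^sub>0]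
        symG[of y x] symG[of z x] symG[of z y] symG[of w x] symG[of w y] symG[of w z]
      from uv show ?thesis
        by (elim insertE emptyE; simp only: g irrT irrG syms pres)
    qed
    ultimately have gE: "g \<in> ?E"
      by (simp add: g)
    show "H \<in> (\<lambda>g. induce_subgraph (with_proj G) (g ` pverts T)) ` ?E"
      by (rule image_eqI[OF _ gE]) (simp add: H g VT)
  qed
  finally show ?thesis .
qed

text \<open>Every fibre of \<open>h\<close> on \<open>R\<close> consists of a pair and its swap,
  which differ because \<open>R\<close> is irreflexive.\<close>

lemma card_image_sym_pairs:
  assumes "finite R" "irrefl R" "sym R"
    and "\<And>p q. p \<in> R \<Longrightarrow> q \<in> R \<Longrightarrow> h p = h q \<longleftrightarrow> q = p \<or> q = prod.swap p"
  shows "card R = 2 * card (h ` R)"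
proof -
  have "card R = (\<Sum>c\<in>h ` R. card {p \<in> R. h p = c})"
    using sum.image_gen[OF assms(1), of "\<lambda>_. 1 :: nat" h] by simp
  also have "\<dots> = (\<Sum>c\<in>h ` R. 2)"
  proof (rule sum.cong[OF refl])
    fix c assume "c \<in> h ` R"
    then obtain z w where p: "(z, w) \<in> R" "c = h (z, w)"
      by (metis imageE prod.collapse)
    have wz: "(w, z) \<in> R"
      using p(1) assms(3) by (simp add: sym_def)
    have "h q = c \<longleftrightarrow> q = (z, w) \<or> q = (w, z)" if "q \<in> R" for q
      using assms(4)[OF p(1) that] p(2) by (simp add: eq_commute[of "h q"])
    then have "{p \<in> R. h p = c} = {(z, w), (w, z)}"
      using p(1) wz by blast
    moreover have "z \<noteq> w"
      using p assms(2) by (auto simp: irrefl_def)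
    ultimately show "card {p \<in> R. h p = c} = 2"
      by simp
  qed
  finally show ?thesis by simp
qed

text \<open>Arcs are ordered, so an edge with both ends in \<open>P\<close> and in \<open>Q\<close>
  counts twice. In exchange the count is additive in each argument without case
  distinctions.\<close>

definition arc_count :: "'a pair_pre_digraph \<Rightarrow> 'a set \<Rightarrow> 'a set \<Rightarrow> nat" where
  "arc_count G P Q = card (parcs G \<inter> P \<times> Q)"

definition adj_class :: "'a pair_pre_digraph \<Rightarrow> 'a \<Rightarrow> 'a \<Rightarrow> bool \<Rightarrow> bool \<Rightarrow> 'a set" where
  "adj_class G x y a b =
     {z \<in> pverts G. z \<noteq> x \<and> z \<noteq> y \<and> ((x, z) \<in> parcs G \<longleftrightarrow> a) \<and> ((y, z) \<in> parcs G \<longleftrightarrow> b)}"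

section \<open>Class sizes and arc counts around a pair of vertices\<close>

locale srg =
  fixes G :: "'a pair_pre_digraph" and v k l m :: nat
  assumes srg: "strongly_regular G v k l m"
begin

lemma is_pair_graph: "pair_graph G"
  using srg by (simp add: strongly_regular_def)

lemma fin: "finite (pverts G)" and arcs_sub: "parcs G \<subseteq> pverts G \<times> pverts G"
  and arc_sym: "(u, w) \<in> parcs G \<longleftrightarrow> (w, u) \<in> parcs G" and arc_irrefl: "(u, u) \<notin> parcs G"
  using is_pair_graph by (auto simp: pair_graph_iff sym_def irrefl_def)

lemma fin_arcs: "finite (parcs G)"
  using fin arcs_sub by (meson finite_SigmaI finite_subset)

lemma card_nbrs: "x \<in> pverts G \<Longrightarrow> card {w. (x, w) \<in> parcs G} = k"
proof -
  assume x: "x \<in> pverts G"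
  have "out_arcs (with_proj G) x = Pair x ` {w. (x, w) \<in> parcs G}"
    by (auto simp: out_arcs_def)
  then have "out_degree (with_proj G) x = card {w. (x, w) \<in> parcs G}"
    by (simp add: out_degree_def card_image inj_on_def)
  then show ?thesis
    using srg x by (simp add: strongly_regular_def)
qed

lemma arc_count_eq_sum:
  assumes "finite P"
  shows "arc_count G P Q = (\<Sum>z\<in>P. card {w \<in> Q. (z, w) \<in> parcs G})"
proof -
  have "parcs G \<inter> P \<times> Q = Sigma P (\<lambda>z. {w \<in> Q. (z, w) \<in> parcs G})"
    by auto
  moreover have "finite {w \<in> Q. (z, w) \<in> parcs G}" for z
    by (rule finite_subset[OF _ fin]) (use arcs_sub in auto)
  ultimately show ?thesis
    using assms by (simp add: arc_count_def)
qed

lemma arc_count_commute: "arc_count G P Q = arc_count G Q P"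
proof -
  have "parcs G \<inter> Q \<times> P = (parcs G \<inter> P \<times> Q)^-1"
    using arc_sym by blast
  then show ?thesis
    by (simp add: arc_count_def card_inverse)
qed

lemma arc_count_Un:
  "Q \<inter> Q' = {} \<Longrightarrow> arc_count G P (Q \<union> Q') = arc_count G P Q + arc_count G P Q'"
  unfolding arc_count_def Sigma_Un_distrib2 Int_Un_distrib
  by (subst card_Un_disjoint) (use fin_arcs in auto)

lemma arc_count_const:
  assumes "P \<subseteq> pverts G" "\<And>z. z \<in> P \<Longrightarrow> card {w \<in> Q. (z, w) \<in> parcs G} = c"
  shows "arc_count G P Q = card P * c"
  using assms finite_subset[OF assms(1) fin] by (simp add: arc_count_eq_sum)

lemma card_common:
  assumes "z \<in> pverts G" "x \<in> pverts G" "z \<noteq> x"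
  shows "card {w. (x, w) \<in> parcs G \<and> (z, w) \<in> parcs G} = (if (x, z) \<in> parcs G then l else m)"
proof -
  have "{w. (x, w) \<in> parcs G \<and> (z, w) \<in> parcs G} = common_neighbours G x z"
    using arcs_sub by (auto simp: common_neighbours_def)
  then show ?thesis
    using srg assms by (auto simp: strongly_regular_def)
qed

context
  fixes x y assumes x: "x \<in> pverts G" and y: "y \<in> pverts G" and xy: "x \<noteq> y"
begin

abbreviation "\<T> \<equiv> adj_class G x y"
abbreviation "\<eta> \<equiv> (x, y) \<in> parcs G"

lemma fin_type: "finite (\<T> a b)"
  using fin by (simp add: adj_class_def)

lemma type_sub: "\<T> a b \<subseteq> pverts G"
  by (auto simp: adj_class_def)

lemma self_notin_type: "x \<notin> \<T> a b" "y \<notin> \<T> a b"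
  by (auto simp: adj_class_def)

lemma type_disjoint: "(a, b) \<noteq> (c, d) \<Longrightarrow> \<T> a b \<inter> \<T> c d = {}"
  by (auto simp: adj_class_def)

lemma nbrs_x: "{w. (x, w) \<in> parcs G} = (\<T> True True \<union> \<T> True False) \<union> (if \<eta> then {y} else {})"
  using arc_irrefl arcs_sub xy by (auto simp: adj_class_def)

lemma nbrs_y: "{w. (y, w) \<in> parcs G} = (\<T> True True \<union> \<T> False True) \<union> (if \<eta> then {x} else {})"
  using arc_irrefl arcs_sub xy arc_sym by (auto simp: adj_class_def)

lemma verts_types:
  "pverts G = (\<T> True True \<union> \<T> True False \<union> (\<T> False True \<union> \<T> False False)) \<union> {x, y}"
  using x y by (auto simp: adj_class_def)

text \<open>This and the next three lemmas are linear equations for the sizes of the four classes,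
  which solve successively in terms of the parameters and the adjacency of \<open>x\<close> and
  \<open>y\<close>.\<close>

lemma type_count_common: "card (\<T> True True) = (if \<eta> then l else m)"
proof -
  have "\<T> True True = {w. (x, w) \<in> parcs G \<and> (y, w) \<in> parcs G}"
    using arc_irrefl arcs_sub by (auto simp: adj_class_def)
  then show ?thesis
    using card_common[OF y x] xy by simp
qed

lemma type_count_x: "card (\<T> True True) + card (\<T> True False) + (if \<eta> then 1 else 0) = k"
proof -
  have "card ((\<T> True True \<union> \<T> True False) \<union> (if \<eta> then {y} else {})) =
     card (\<T> True True) + card (\<T> True False) + (if \<eta> then 1 else 0)"
    using card_Un_disjoint[OF fin_type fin_type type_disjoint, of True True True False]
      card_Un_disjoint[of "\<T> True True \<union> \<T> True False" "if \<eta> then {y} else {}"]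
    by (simp add: fin_type self_notin_type)
  then show ?thesis
    using card_nbrs[OF x] by (simp add: nbrs_x)
qed

lemma type_count_y: "card (\<T> True True) + card (\<T> False True) + (if \<eta> then 1 else 0) = k"
proof -
  have "card ((\<T> True True \<union> \<T> False True) \<union> (if \<eta> then {x} else {})) =
     card (\<T> True True) + card (\<T> False True) + (if \<eta> then 1 else 0)"
    using card_Un_disjoint[OF fin_type fin_type type_disjoint, of True True False True]
      card_Un_disjoint[of "\<T> True True \<union> \<T> False True" "if \<eta> then {x} else {}"]
    by (simp add: fin_type self_notin_type)
  then show ?thesis
    using card_nbrs[OF y] by (simp add: nbrs_y)
qed

lemma type_count_all:
  "card (\<T> True True) + card (\<T> True False) + (card (\<T> False True) + card (\<T> False False)) + 2 = v"
proof -
  have "(\<T> True True \<union> \<T> True False \<union> (\<T> False True \<union> \<T> False False)) \<inter> {x, y} = {}"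
    by (auto simp: adj_class_def)
  then have "card (pverts G) = card (\<T> True True \<union> \<T> True False \<union> (\<T> False True \<union> \<T> False False)) + card {x, y}"
    using card_Un_disjoint[of "\<T> True True \<union> \<T> True False \<union> (\<T> False True \<union> \<T> False False)" "{x, y}"]
    by (simp only: verts_types[symmetric] fin_type finite_Un finite.intros simp_thms)
  also have "card (\<T> True True \<union> \<T> True False \<union> (\<T> False True \<union> \<T> False False)) =
    card (\<T> True True \<union> \<T> True False) + card (\<T> False True \<union> \<T> False False)"
    by (rule card_Un_disjoint) (simp_all add: fin_type, auto simp: adj_class_def)
  finally show ?thesis
    using xy srg type_disjoint by (simp add: card_Un_disjoint fin_type strongly_regular_def)
qed

text \<open>Both sides count the arcs from the class to the full neighbourhood of \<open>x\<close>:
  every \<open>z\<close> in the class has \<open>l\<close> or \<open>m\<close> common neighbours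
  with \<open>x\<close>. The correction term accounts for \<open>y\<close>, which is a neighbour of
  \<open>x\<close> when \<eta> holds but lies in no class.\<close>

lemma type_arcs_x:
  "arc_count G (\<T> a b) (\<T> True True) + arc_count G (\<T> a b) (\<T> True False) +
    (if \<eta> \<and> b then card (\<T> a b) else 0) = card (\<T> a b) * (if a then l else m)"
proof -
  have "arc_count G (\<T> a b) {w. (x, w) \<in> parcs G} = card (\<T> a b) * (if a then l else m)"
    by (rule arc_count_const[OF type_sub])
      (use card_common[OF _ x] in \<open>auto simp: adj_class_def\<close>)
  moreover have "arc_count G (\<T> a b) (if \<eta> then {y} else {}) = (if \<eta> \<and> b then card (\<T> a b) else 0)"
  proof (cases \<eta>)
    case True
    have "arc_count G (\<T> a b) {y} = card (\<T> a b) * (if b then 1 else 0)"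
    proof (rule arc_count_const[OF type_sub])
      fix z assume "z \<in> \<T> a b"
      then have "{w \<in> {y}. (z, w) \<in> parcs G} = (if b then {y} else {})"
        using arc_sym by (auto simp: adj_class_def)
      then show "card {w \<in> {y}. (z, w) \<in> parcs G} = (if b then 1 else 0)"
        by simp
    qed
    then show ?thesis
      using True by simp
  qed (simp add: arc_count_def)
  moreover have "(\<T> True True \<union> \<T> True False) \<inter> (if \<eta> then {y} else {}) = {}"
    by (auto simp: adj_class_def)
  ultimately show ?thesis
    by (simp add: nbrs_x arc_count_Un type_disjoint)
qed

lemma type_arcs_y:
  "arc_count G (\<T> a b) (\<T> True True) + arc_count G (\<T> a b) (\<T> False True) +
    (if \<eta> \<and> a then card (\<T> a b) else 0) = card (\<T> a b) * (if b then l else m)"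
proof -
  have "arc_count G (\<T> a b) {w. (y, w) \<in> parcs G} = card (\<T> a b) * (if b then l else m)"
    by (rule arc_count_const[OF type_sub])
      (use card_common[OF _ y] in \<open>auto simp: adj_class_def\<close>)
  moreover have "arc_count G (\<T> a b) (if \<eta> then {x} else {}) = (if \<eta> \<and> a then card (\<T> a b) else 0)"
  proof (cases \<eta>)
    case True
    have "arc_count G (\<T> a b) {x} = card (\<T> a b) * (if a then 1 else 0)"
    proof (rule arc_count_const[OF type_sub])
      fix z assume "z \<in> \<T> a b"
      then have "{w \<in> {x}. (z, w) \<in> parcs G} = (if a then {x} else {})"
        using arc_sym by (auto simp: adj_class_def)
      then show "card {w \<in> {x}. (z, w) \<in> parcs G} = (if a then 1 else 0)"
        by simp
    qed
    then show ?thesis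
      using True by simp
  qed (simp add: arc_count_def)
  moreover have "(\<T> True True \<union> \<T> False True) \<inter> (if \<eta> then {x} else {}) = {}"
    by (auto simp: adj_class_def)
  ultimately show ?thesis
    by (simp add: nbrs_y arc_count_Un type_disjoint)
qed

text \<open>Both sides count all arcs leaving the class, \<open>k\<close> at each vertex; the last
  bracket collects those ending in \<open>x\<close> or \<open>y\<close>.\<close>

lemma type_arcs_all:
  "arc_count G (\<T> a b) (\<T> True True) + arc_count G (\<T> a b) (\<T> True False) +
   (arc_count G (\<T> a b) (\<T> False True) + arc_count G (\<T> a b) (\<T> False False)) +
   ((if a then card (\<T> a b) else 0) + (if b then card (\<T> a b) else 0)) = card (\<T> a b) * k"
proof -
  have "arc_count G (\<T> a b) (pverts G) = card (\<T> a b) * k"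
  proof (rule arc_count_const[OF type_sub])
    fix z assume "z \<in> \<T> a b"
    moreover have "{w \<in> pverts G. (z, w) \<in> parcs G} = {w. (z, w) \<in> parcs G}"
      using arcs_sub by auto
    ultimately show "card {w \<in> pverts G. (z, w) \<in> parcs G} = k"
      using card_nbrs[of z] type_sub by auto
  qed
  moreover have "arc_count G (\<T> a b) {x, y} =
     card (\<T> a b) * ((if a then 1 else 0) + (if b then 1 else 0))"
  proof (rule arc_count_const[OF type_sub])
    fix z assume "z \<in> \<T> a b"
    then have "{w \<in> {x, y}. (z, w) \<in> parcs G} = (if a then {x} else {}) \<union> (if b then {y} else {})"
      using arc_sym by (auto simp: adj_class_def)
    then show "card {w \<in> {x, y}. (z, w) \<in> parcs G} = (if a then 1 else 0) + (if b then 1 else 0)"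
      using xy by simp
  qed
  moreover have "arc_count G (\<T> a b) (pverts G) =
      arc_count G (\<T> a b) (\<T> True True \<union> \<T> True False) +
      arc_count G (\<T> a b) (\<T> False True \<union> \<T> False False) + arc_count G (\<T> a b) {x, y}"
    by (subst verts_types, subst arc_count_Un, (auto simp: adj_class_def)[],
        subst arc_count_Un) (auto simp: adj_class_def)
  ultimately show ?thesis
    by (simp add: arc_count_Un type_disjoint split: if_splits)
qed

end

lemma type_count_cong:
  assumes "x \<in> pverts G" "y \<in> pverts G" "x \<noteq> y" "x' \<in> pverts G" "y' \<in> pverts G" "x' \<noteq> y'"
    and "(x, y) \<in> parcs G \<longleftrightarrow> (x', y') \<in> parcs G"
  shows "card (adj_class G x y a b) = card (adj_class G x' y' a b)"
  using type_count_common[OF assms(1-3)] type_count_common[OF assms(4-6)]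
    type_count_x[OF assms(1-3)] type_count_x[OF assms(4-6)]
    type_count_y[OF assms(1-3)] type_count_y[OF assms(4-6)]
    type_count_all[OF assms(1-3)] type_count_all[OF assms(4-6)] assms(7)
  by (cases a; cases b) auto

text \<open>
  Regularity determines the row sums of the matrix of arc counts between the four adjacency classes,
  which leaves one degree of freedom: the number of arcs among the common neighbours.
\<close>

lemma type_arcs_cong:
  assumes xy: "x \<in> pverts G" "y \<in> pverts G" "x \<noteq> y"
    and xy': "x' \<in> pverts G" "y' \<in> pverts G" "x' \<noteq> y'"
    and adj: "(x, y) \<in> parcs G \<longleftrightarrow> (x', y') \<in> parcs G"
    and base: "arc_count G (adj_class G x y True True) (adj_class G x y True True) =
       arc_count G (adj_class G x' y' True True) (adj_class G x' y' True True)"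
  shows "arc_count G (adj_class G x y a b) (adj_class G x y c d) =
       arc_count G (adj_class G x' y' a b) (adj_class G x' y' c d)"
proof -
  note cc = type_count_cong[OF xy xy' adj]
  have step: "arc_count G (adj_class G x y a b) (adj_class G x y c d) =
       arc_count G (adj_class G x' y' a b) (adj_class G x' y' c d)"
    if "arc_count G (adj_class G x y a b) (adj_class G x y True True) =
       arc_count G (adj_class G x' y' a b) (adj_class G x' y' True True)" for a b c d
  proof -
    have "arc_count G (adj_class G x y a b) (adj_class G x y True False) =
       arc_count G (adj_class G x' y' a b) (adj_class G x' y' True False)"
      using type_arcs_x[OF xy, of a b] type_arcs_x[OF xy', of a b] that unfolding cc adj by simp
    moreover have "arc_count G (adj_class G x y a b) (adj_class G x y False True) =
       arc_count G (adj_class G x' y' a b) (adj_class G x' y' False True)"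
      using type_arcs_y[OF xy, of a b] type_arcs_y[OF xy', of a b] that unfolding cc adj by simp
    moreover have "arc_count G (adj_class G x y a b) (adj_class G x y False False) =
       arc_count G (adj_class G x' y' a b) (adj_class G x' y' False False)"
      using type_arcs_all[OF xy, of a b] type_arcs_all[OF xy', of a b] that calculation
      unfolding cc by simp
    ultimately show ?thesis
      using that by (cases c; cases d) simp_all
  qed
  \<comment> \<open>Applied to \<open>base\<close>, \<open>step\<close> gives the row of the class
    of common neighbours. By symmetry of the counts this is also the corresponding column, from
    which \<open>step\<close> gives every other row.\<close>
  show ?thesis
    by (rule step) (use step[OF base, of a b] in \<open>simp add: arc_count_commute\<close>)
qed

text \<open>A copy amounts to a pair \<open>(z, w)\<close> from two prescribed classes with
  prescribed adjacency. The number of such pairs comes from class sizes and arc counts, all of which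
  depend only on the adjacency of \<open>x\<close> and \<open>y\<close> once the count inside the
  common neighbourhood does.\<close>

lemma vertex_condition_four:
  assumes f: "\<And>x y. x \<in> pverts G \<Longrightarrow> y \<in> pverts G \<Longrightarrow> x \<noteq> y \<Longrightarrow>
     card (parcs G \<inter> common_neighbours G x y \<times> common_neighbours G x y) = f ((x, y) \<in> parcs G)"
  shows "vertex_condition 4 G"
  unfolding vertex_condition_def
proof (intro allI impI ballI, elim conjE)
  fix T :: "nat pair_pre_digraph" and x\<^sub>0 y\<^sub>0 x y x' y'
  assume T: "pair_graph T" "card (pverts T) = 4" and x0: "x\<^sub>0 \<in> pverts T" "y\<^sub>0 \<in> pverts T" "x\<^sub>0 \<noteq> y\<^sub>0"
    and xy: "x \<in> pverts G" "y \<in> pverts G" and xy': "x' \<in> pverts G" "y' \<in> pverts G"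
    and ne: "x \<noteq> y" "x' \<noteq> y'" and adj: "(x, y) \<in> parcs G \<longleftrightarrow> (x', y') \<in> parcs G"
  have "finite (pverts T)"
    using T(2) card.infinite by fastforce
  then have "card (pverts T - {x\<^sub>0, y\<^sub>0}) = 2"
    using T(2) x0 by (simp add: card_Diff_subset)
  then obtain z\<^sub>0 w\<^sub>0 where zw0: "pverts T - {x\<^sub>0, y\<^sub>0} = {z\<^sub>0, w\<^sub>0}" "z\<^sub>0 \<noteq> w\<^sub>0"
    by (auto simp: card_2_iff)
  have VT: "pverts T = {x\<^sub>0, y\<^sub>0, z\<^sub>0, w\<^sub>0}" and dist: "distinct [x\<^sub>0, y\<^sub>0, z\<^sub>0, w\<^sub>0]"
    using zw0 x0 by auto
  define a b c d e where "a = ((x\<^sub>0, z\<^sub>0) \<in> parcs T)" and "b = ((y\<^sub>0, z\<^sub>0) \<in> parcs T)"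
    and "c = ((x\<^sub>0, w\<^sub>0) \<in> parcs T)" and "d = ((y\<^sub>0, w\<^sub>0) \<in> parcs T)" and "e = ((z\<^sub>0, w\<^sub>0) \<in> parcs T)"
  note abcde = this
  define R where "R = (\<lambda>x y. {(z, w). z \<in> adj_class G x y a b \<and> w \<in> adj_class G x y c d \<and> z \<noteq> w \<and>
    ((z, w) \<in> parcs G \<longleftrightarrow> e)})"
  define h where "h = (\<lambda>x y (z, w). induce_subgraph (with_proj G) {x, y, z, w})"
  have base: "arc_count G (adj_class G x y True True) (adj_class G x y True True) = f ((x, y) \<in> parcs G)"
    if "x \<in> pverts G" "y \<in> pverts G" "x \<noteq> y" for x y
  proof -
    have "adj_class G x y True True = common_neighbours G x y"
      using arc_irrefl by (auto simp: adj_class_def common_neighbours_def)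
    then show ?thesis
      using f[OF that] by (simp add: arc_count_def)
  qed
  have R_sub: "R x y \<subseteq> pverts G \<times> pverts G" for x y
    by (auto simp: R_def adj_class_def)
  have fin_R: "finite (R x y)" for x y
    using R_sub fin finite_subset by (metis finite_SigmaI)
  \<comment> \<open>There are no copies at all if the adjacency of \<open>x\<close>,
    \<open>y\<close> disagrees with that of the distinguished vertices, a condition that again sees
    only the adjacency.\<close>
  have copies: "induced_copies T x\<^sub>0 y\<^sub>0 G x y =
      (if (x, y) \<in> parcs G \<longleftrightarrow> (x\<^sub>0, y\<^sub>0) \<in> parcs T then h x y ` R x y else {})"
    if "x \<in> pverts G" "y \<in> pverts G" "x \<noteq> y" for x y
    unfolding induced_copies_four[OF T(1) is_pair_graph VT dist that] h_def
    using that by (auto simp: R_def adj_class_def abcde intro!: image_cong)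
  have card_R: "card (R x y) = (if e then arc_count G (adj_class G x y a b) (adj_class G x y c d)
      else card (adj_class G x y a b) * card (adj_class G x y c d) -
        arc_count G (adj_class G x y a b) (adj_class G x y c d) -
        (if (a, b) = (c, d) then card (adj_class G x y a b) else 0))"
    if "x \<in> pverts G" "y \<in> pverts G" "x \<noteq> y" for x y
  proof -
    let ?P = "adj_class G x y a b" and ?Q = "adj_class G x y c d"
    note finT = fin_type[OF that]
    show ?thesis
    proof (cases e)
      case True
      then have "R x y = parcs G \<inter> ?P \<times> ?Q"
        using arc_irrefl by (auto simp: R_def)
      then show ?thesis
        using True by (simp add: arc_count_def)
    next
      case False
      \<comment> \<open>Non-arcs are obtained by removing from the product first the arcs and then
        the diagonal, which is nonempty only if the two classes coincide.\<close>
      have "R x y = (?P \<times> ?Q - parcs G \<inter> ?P \<times> ?Q) - (\<lambda>z. (z, z)) ` (?P \<inter> ?Q)"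
        using False by (auto simp: R_def)
      moreover have "(\<lambda>z. (z, z)) ` (?P \<inter> ?Q) \<subseteq> ?P \<times> ?Q - parcs G \<inter> ?P \<times> ?Q"
        using arc_irrefl by auto
      moreover have "card (?P \<inter> ?Q) = (if (a, b) = (c, d) then card ?P else 0)"
        using type_disjoint[OF that, of a b c d] by auto
      moreover have "card (?P \<times> ?Q - parcs G \<inter> ?P \<times> ?Q) = card ?P * card ?Q - arc_count G ?P ?Q"
        unfolding arc_count_def by (subst card_Diff_subset) (auto simp: finT card_cartesian_product)
      ultimately show ?thesis
        using False by (simp add: card_Diff_subset finT card_image inj_on_def)
    qed
  qed
  have R_eq: "card (R x y) = card (R x' y')"
    unfolding card_R[OF xy ne(1)] card_R[OF xy' ne(2)]
    using type_arcs_cong[OF xy ne(1) xy' ne(2) adj] base[OF xy ne(1)] base[OF xy' ne(2)] adj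
      type_count_cong[OF xy ne(1) xy' ne(2) adj] by simp
  have h_eq: "h x y p = h x y q \<longleftrightarrow> q = p \<or> q = prod.swap p" if "p \<in> R x y" "q \<in> R x y" for x y p q
  proof -
    obtain z w z' w' where pq: "p = (z, w)" "q = (z', w')"
      by fastforce
    have "h x y p = h x y q \<longleftrightarrow> {x, y, z, w} = {x, y, z', w'}"
      unfolding h_def pq by (metis case_prod_conv induce_subgraph_verts)
    also have "\<dots> \<longleftrightarrow> {z, w} = {z', w'}"
      using that unfolding pq R_def adj_class_def by blast
    finally show ?thesis
      by (auto simp: pq doubleton_eq_iff)
  qed
  \<comment> \<open>If \<open>z\<close> and \<open>w\<close> come from the same class, swapping them
    gives the same copy, hence the division by 2. If the classes differ, they tell \<open>z\<close>
    and \<open>w\<close> apart.\<close>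
  have card_h: "card (h x y ` R x y) = (if (a, b) = (c, d) then card (R x y) div 2 else card (R x y))"
    for x y
  proof (cases "(a, b) = (c, d)")
    case True
    have "card (R x y) = 2 * card (h x y ` R x y)"
    proof (rule card_image_sym_pairs[OF fin_R _ _ h_eq])
      show "irrefl (R x y)" "sym (R x y)"
        using True arc_sym by (auto simp: R_def irrefl_def sym_def)
    qed
    then show ?thesis
      using True by simp
  next
    case False
    have "inj_on (h x y) (R x y)"
    proof (rule inj_onI)
      fix p q assume pq: "p \<in> R x y" "q \<in> R x y" "h x y p = h x y q"
      then have "q = p \<or> q = prod.swap p"
        using h_eq by blast
      moreover have "q \<noteq> prod.swap p"
        using pq False by (auto simp: R_def adj_class_def)
      ultimately show "p = q"
        by simp
    qed
    from card_image[OF this] show ?thesis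
      by (simp only: False if_False)
  qed
  show "card (induced_copies T x\<^sub>0 y\<^sub>0 G x y) = card (induced_copies T x\<^sub>0 y\<^sub>0 G x' y')"
    using adj by (simp add: copies[OF xy ne(1)] copies[OF xy' ne(2)] card_h R_eq)
qed

end

section \<open>Perfect matchings\<close>

definition matching_graph :: "nat \<Rightarrow> nat pair_pre_digraph" where
  "matching_graph m = \<lparr>pverts = {..<2 * m},
     parcs = {(x, y). x < 2 * m \<and> y < 2 * m \<and> (y = x + m \<or> x = y + m)}\<rparr>"

lemma pair_graph_matching_graph:
  assumes "m > 0"
  shows "pair_graph (matching_graph m)"
  using assms by (auto simp: pair_graph_iff matching_graph_def sym_def irrefl_def)

lemma common_neighbours_matching_graph:
  "x \<noteq> y \<Longrightarrow> common_neighbours (matching_graph m) x y = {}"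
  by (auto simp: common_neighbours_def matching_graph_def)

text \<open>For \<open>m = 1\<close> the matching is a single edge, which is a complete graph; hence
  the bound on \<open>m\<close>.\<close>

lemma strongly_regular_matching_graph:
  assumes "m \<ge> 2"
  shows "strongly_regular (matching_graph m) (2 * m) 1 0 0"
proof -
  have deg: "out_degree (with_proj (matching_graph m)) x = 1" if "x < 2 * m" for x
  proof -
    have "out_arcs (with_proj (matching_graph m)) x = {(x, if x < m then x + m else x - m)}"
      using that by (auto simp: out_arcs_def matching_graph_def)
    then show ?thesis
      by (simp add: out_degree_def)
  qed
  have "(0, 1) \<notin> parcs (matching_graph m)" "(0, m) \<in> parcs (matching_graph m)"
    "0 \<in> pverts (matching_graph m)" "1 \<in> pverts (matching_graph m)"
    using assms by (auto simp: matching_graph_def)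
  then have "\<not> complete_digraph (2 * m) (with_proj (matching_graph m))"
    "parcs (matching_graph m) \<noteq> {}"
    unfolding complete_digraph_pair_def by auto
  moreover have "card (pverts (matching_graph m)) = 2 * m"
    by (simp add: matching_graph_def)
  moreover have "card (common_neighbours (matching_graph m) x y) = 0"
    if "(x, y) \<in> parcs (matching_graph m) \<or> x \<noteq> y" for x y
  proof -
    have "x \<noteq> y"
      using that assms by (auto simp: matching_graph_def)
    then show ?thesis
      by (simp add: common_neighbours_matching_graph)
  qed
  moreover have "\<forall>x\<in>pverts (matching_graph m). out_degree (with_proj (matching_graph m)) x = 1"
    using deg by (simp add: matching_graph_def)
  moreover have "pair_graph (matching_graph m)"
    using assms by (simp add: pair_graph_matching_graph)
  ultimately show ?thesis
    unfolding strongly_regular_def by blast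
qed

lemma vertex_condition_matching_graph:
  assumes "m \<ge> 2"
  shows "vertex_condition 4 (matching_graph m)"
proof -
  interpret srg "matching_graph m" "2 * m" 1 0 0
    by unfold_locales (rule strongly_regular_matching_graph[OF assms])
  show ?thesis
    by (rule vertex_condition_four[where f = "\<lambda>_. 0"]) (simp add: common_neighbours_matching_graph)
qed

lemma not_iso_matching_graph:
  assumes "m > 0" "m \<noteq> n"
  shows "\<not> digraph_iso (with_proj (matching_graph m)) (with_proj (matching_graph n))"
proof
  assume "digraph_iso (with_proj (matching_graph m)) (with_proj (matching_graph n))"
  then obtain g where "bij_betw g (pverts (matching_graph m)) (pverts (matching_graph n))"
    using pair_graph_matching_graph[OF assms(1)] by (metis digraph_iso_with_projD)
  from bij_betw_same_card[OF this] show False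
    using assms by (simp add: matching_graph_def)
qed

text \<open>Matchings are told apart by their order, and the even orders from 4 up to
  \<open>v\<close> are available.\<close>

lemma many_matching_graphs:
  fixes v :: nat
  defines "S \<equiv> matching_graph ` {2..v div 2}"
  shows "finite S" "card S = v div 2 - 1"
    "\<forall>G\<in>S. (\<exists>n k l m. n \<le> v \<and> strongly_regular G n k l m) \<and> vertex_condition 4 G"
    "pairwise (\<lambda>G H. \<not> digraph_iso (with_proj G) (with_proj H)) S"
proof -
  have "inj_on matching_graph {2..v div 2}"
    by (auto simp: inj_on_def matching_graph_def lessThan_eq_iff)
  then show "finite S" "card S = v div 2 - 1"
    by (auto simp: S_def card_image)
  have "\<exists>n k l m'. n \<le> v \<and> strongly_regular (matching_graph m) n k l m'" if "m \<in> {2..v div 2}" for m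
  proof -
    have "2 * m \<le> v" "m \<ge> 2"
      using that by auto
    then show ?thesis
      using strongly_regular_matching_graph by blast
  qed
  then show "\<forall>G\<in>S. (\<exists>n k l m. n \<le> v \<and> strongly_regular G n k l m) \<and> vertex_condition 4 G"
    using vertex_condition_matching_graph by (auto simp: S_def)
  show "pairwise (\<lambda>G H. \<not> digraph_iso (with_proj G) (with_proj H)) S"
  proof (rule pairwiseI)
    fix G H assume "G \<in> S" "H \<in> S" "G \<noteq> H"
    then obtain m n where "G = matching_graph m" "H = matching_graph n" "m > 0" "m \<noteq> n"
      unfolding S_def by fastforce
    then show "\<not> digraph_iso (with_proj G) (with_proj H)"
      by (simp add: not_iso_matching_graph)
  qed
qed

section \<open>Graphs from Hadamard matrices\<close>

text \<open>\<open>o\<^sub>V\<close> is the index of the all-one row, and \<open>M_quad\<close> says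
  that the quadratic form of \<open>M\<close> takes the value \<open>card V\<close> at the entrywise
  product of any two rows. Order 4 is excluded because its graph would be a triangle, which is
  complete.\<close>

locale quadratic_hadamard =
  fixes V :: "'a set" and o\<^sub>V :: 'a and M :: "'a \<Rightarrow> 'a \<Rightarrow> int"
  assumes fin_V: "finite V" and o_in: "o\<^sub>V \<in> V" and large: "card V > 4"
    and M_sym: "x \<in> V \<Longrightarrow> y \<in> V \<Longrightarrow> M x y = M y x"
    and M_vals: "x \<in> V \<Longrightarrow> y \<in> V \<Longrightarrow> M x y = 1 \<or> M x y = -1"
    and M_diag: "x \<in> V \<Longrightarrow> M x x = 1"
    and M_o: "x \<in> V \<Longrightarrow> M o\<^sub>V x = 1"
    and M_orth: "x \<in> V \<Longrightarrow> y \<in> V \<Longrightarrow> (\<Sum>z\<in>V. M x z * M y z) = (if x = y then int (card V) else 0)"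
    and M_quad: "x \<in> V \<Longrightarrow> y \<in> V \<Longrightarrow>
      (\<Sum>z\<in>V. \<Sum>w\<in>V. (M x z * M y z) * (M x w * M y w) * M z w) = int (card V)"
begin

text \<open>The index \<open>o\<^sub>V\<close> is left out because its row is constantly 1, so that
  it would be an isolated vertex.\<close>

definition graph where
  "graph = \<lparr>pverts = V - {o\<^sub>V}, parcs = {(x, y) \<in> (V - {o\<^sub>V}) \<times> (V - {o\<^sub>V}). M x y = -1}\<rparr>"

lemma M_o': "x \<in> V \<Longrightarrow> M x o\<^sub>V = 1"
  using M_o M_sym o_in by metis

lemma arc_iff: "x \<in> V \<Longrightarrow> y \<in> V \<Longrightarrow> (x, y) \<in> parcs graph \<longleftrightarrow> M x y = -1"
  by (auto simp: graph_def M_o M_o')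

lemma row_sum: "x \<in> V - {o\<^sub>V} \<Longrightarrow> (\<Sum>z\<in>V. M x z) = 0"
  using M_orth[of x o\<^sub>V] o_in by (simp add: M_o)

lemma pair_graph: "pair_graph graph"
  using fin_V M_diag M_sym by (auto simp: pair_graph_iff graph_def sym_def irrefl_def)

text \<open>The term \<open>1 - M x z\<close> is 2 on arcs and 0 elsewhere, and the row of
  \<open>x\<close> sums to 0 because it is orthogonal to the all-one row.\<close>

lemma degree:
  assumes x: "x \<in> V - {o\<^sub>V}"
  shows "2 * card {z. (x, z) \<in> parcs graph} = card V"
proof -
  have "int (2 * card {z. (x, z) \<in> parcs graph}) = (\<Sum>z\<in>{z\<in>V. (x, z) \<in> parcs graph}. 2)"
    by (simp, rule arg_cong[of _ _ card]) (auto simp: graph_def)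
  also have "\<dots> = (\<Sum>z\<in>V. if (x, z) \<in> parcs graph then 2 else 0)"
    by (rule sum.inter_filter[OF fin_V])
  also have "\<dots> = (\<Sum>z\<in>V. 1 - M x z)"
    using x M_vals by (intro sum.cong) (auto simp: arc_iff)
  also have "\<dots> = int (card V)"
    by (simp add: sum_subtractf row_sum[OF x])
  finally show ?thesis
    by linarith
qed

lemma common_neighbours_indicator:
  assumes "x \<in> V" "y \<in> V" "z \<in> V"
  shows "(1 - M x z) * (1 - M y z) = (if z \<in> common_neighbours graph x y then 4 else 0)"
proof -
  have "z \<in> common_neighbours graph x y \<longleftrightarrow> M x z = -1 \<and> M y z = -1"
    using assms arc_iff by (auto simp: common_neighbours_def graph_def)
  then show ?thesis
    using M_vals[of x z] M_vals[of y z] assms by auto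
qed

lemma common_neighbours_sub: "common_neighbours graph x y \<subseteq> V"
  by (auto simp: common_neighbours_def graph_def)

lemma common_neighbours_sum:
  assumes x: "x \<in> V - {o\<^sub>V}" and y: "y \<in> V - {o\<^sub>V}" and xy: "x \<noteq> y"
  shows "(\<Sum>z\<in>V. (1 - M x z) * (1 - M y z)) = int (card V)"
proof -
  have "(\<Sum>z\<in>V. (1 - M x z) * (1 - M y z)) = (\<Sum>z\<in>V. 1 - M x z - M y z + M x z * M y z)"
    by (simp add: algebra_simps)
  also have "\<dots> = int (card V)"
    using row_sum[OF x] row_sum[OF y] M_orth[of x y] x y xy by (simp add: sum.distrib sum_subtractf)
  finally show ?thesis .
qed

lemma card_common_neighbours:
  assumes x: "x \<in> V - {o\<^sub>V}" and y: "y \<in> V - {o\<^sub>V}" and xy: "x \<noteq> y"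
  shows "4 * card (common_neighbours graph x y) = card V"
proof -
  have "(\<Sum>z\<in>V. (1 - M x z) * (1 - M y z)) = (\<Sum>z\<in>V. if z \<in> common_neighbours graph x y then 4 else 0)"
    by (rule sum.cong) (use x y common_neighbours_indicator in auto)
  also have "\<dots> = (\<Sum>z\<in>{z \<in> V. z \<in> common_neighbours graph x y}. 4)"
    by (rule sum.inter_filter[OF fin_V, symmetric])
  also have "{z \<in> V. z \<in> common_neighbours graph x y} = common_neighbours graph x y"
    using common_neighbours_sub by auto
  finally show ?thesis
    using common_neighbours_sum[OF assms] by simp
qed

text \<open>
  Expanding the indicator of the common neighbours of \<open>x\<close> and \<open>y\<close> as a combination of the rows
  \<open>o\<^sub>V\<close>, \<open>x\<close>, \<open>y\<close> and their product, only the product with itself is not settled by orthogonality.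
\<close>

lemma common_neighbours_form:
  assumes x: "x \<in> V - {o\<^sub>V}" and y: "y \<in> V - {o\<^sub>V}" and xy: "x \<noteq> y"
  defines "a \<equiv> \<lambda>z. (1 - M x z) * (1 - M y z)"
  shows "(\<Sum>z\<in>V. \<Sum>w\<in>V. a z * a w * M z w) = 2 * int (card V) - 2 * int (card V) * M x y"
proof -
  let ?N = "int (card V)"
  have xV: "x \<in> V" and yV: "y \<in> V" using x y by auto
  \<comment> \<open>As a vector, \<open>s\<close> is \<open>M\<close> applied to the entrywise
    product of the rows \<open>x\<close> and \<open>y\<close>. Since \<open>M\<close> is symmetric
    with square \<open>?N\<close> times the identity, applying \<open>M\<close> again returns
    \<open>?N\<close> times that product; this is \<open>s_row\<close>.\<close>
  define s where "s = (\<lambda>z. \<Sum>w\<in>V. M z w * (M x w * M y w))"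
  have s_row: "(\<Sum>z\<in>V. M c z * s z) = ?N * (M x c * M y c)" if c: "c \<in> V" for c
  proof -
    have "(\<Sum>z\<in>V. M c z * s z) = (\<Sum>z\<in>V. \<Sum>w\<in>V. (M x w * M y w) * (M c z * M z w))"
      by (simp add: s_def sum_distrib_left mult_ac)
    also have "\<dots> = (\<Sum>w\<in>V. (M x w * M y w) * (\<Sum>z\<in>V. M c z * M z w))"
      by (subst sum.swap) (simp add: sum_distrib_left)
    also have "\<dots> = (\<Sum>w\<in>V. (M x w * M y w) * (if w = c then ?N else 0))"
    proof (rule sum.cong[OF refl])
      fix w assume w: "w \<in> V"
      then have "(\<Sum>z\<in>V. M c z * M z w) = (\<Sum>z\<in>V. M c z * M w z)"
        using M_sym by (intro sum.cong) auto
      then show "(M x w * M y w) * (\<Sum>z\<in>V. M c z * M z w) = (M x w * M y w) * (if w = c then ?N else 0)"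
        using M_orth[OF c w] by simp
    qed
    also have "\<dots> = ?N * (M x c * M y c)"
      using fin_V c by (simp add: if_distrib sum.delta' cong: if_cong)
    finally show ?thesis .
  qed
  have inner: "(\<Sum>w\<in>V. a w * M z w) =
      ?N * ((if z = o\<^sub>V then 1 else 0) - (if z = x then 1 else 0) - (if z = y then 1 else 0)) + s z"
    if z: "z \<in> V" for z
  proof -
    have "(\<Sum>w\<in>V. a w * M z w) = (\<Sum>w\<in>V. M z w * M o\<^sub>V w - M z w * M x w - M z w * M y w + M z w * (M x w * M y w))"
      by (rule sum.cong) (auto simp: a_def M_o algebra_simps)
    also have "\<dots> = (\<Sum>w\<in>V. M z w * M o\<^sub>V w) - (\<Sum>w\<in>V. M z w * M x w) - (\<Sum>w\<in>V. M z w * M y w) + s z"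
      by (simp add: sum.distrib sum_subtractf s_def)
    finally show ?thesis
      unfolding M_orth[OF z o_in] M_orth[OF z xV] M_orth[OF z yV] by auto
  qed
  \<comment> \<open>The point masses in \<open>inner\<close> sit exactly where \<open>a\<close>
    vanishes, so only \<open>s\<close> survives when \<open>inner\<close> is weighted with
    \<open>a\<close>.\<close>
  have a0: "a o\<^sub>V = 0" "a x = 0" "a y = 0"
    using xV yV by (simp_all add: a_def M_o' M_diag)
  have "(\<Sum>z\<in>V. \<Sum>w\<in>V. a z * a w * M z w) = (\<Sum>z\<in>V. a z * (\<Sum>w\<in>V. a w * M z w))"
    by (simp add: sum_distrib_left mult_ac)
  also have "\<dots> = (\<Sum>z\<in>V. a z * s z)"
    by (rule sum.cong) (auto simp: inner a0)
  also have "\<dots> = (\<Sum>z\<in>V. M o\<^sub>V z * s z - M x z * s z - M y z * s z + (M x z * M y z) * s z)"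
    by (rule sum.cong) (auto simp: a_def M_o algebra_simps)
  also have "\<dots> = ?N * (M x o\<^sub>V * M y o\<^sub>V) - ?N * (M x x * M y x) - ?N * (M x y * M y y) +
      (\<Sum>z\<in>V. (M x z * M y z) * s z)"
    by (simp add: sum.distrib sum_subtractf s_row o_in xV yV)
  also have "(\<Sum>z\<in>V. (M x z * M y z) * s z) =
      (\<Sum>z\<in>V. \<Sum>w\<in>V. (M x z * M y z) * (M x w * M y w) * M z w)"
    by (simp add: s_def sum_distrib_left mult_ac)
  also have "\<dots> = ?N"
    by (rule M_quad[OF xV yV])
  finally show ?thesis
    using xV yV M_sym[of y x] by (simp add: M_o' M_diag)
qed

text \<open>Summing \<open>a z * a w * (1 - M z w)\<close> over all pairs, with \<open>a\<close>
  equal to 4 on common neighbours and 0 elsewhere, every arc between common neighbours contributes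
  \<open>4 * 4 * 2 = 32\<close> and every other pair contributes 0. The result depends on
  \<open>x\<close> and \<open>y\<close> only through \<open>M x y\<close>, that is, through their
  adjacency.\<close>

lemma card_common_arcs:
  assumes x: "x \<in> V - {o\<^sub>V}" and y: "y \<in> V - {o\<^sub>V}" and xy: "x \<noteq> y"
  shows "32 * int (card (parcs graph \<inter> common_neighbours graph x y \<times> common_neighbours graph x y)) =
    int (card V) * int (card V) - 2 * int (card V) + 2 * int (card V) * M x y"
proof -
  let ?C = "common_neighbours graph x y" and ?N = "int (card V)"
  define a where "a = (\<lambda>z. (1 - M x z) * (1 - M y z))"
  have a: "a z = (if z \<in> ?C then 4 else 0)" if "z \<in> V" for z
    using common_neighbours_indicator[of x y z] x y that by (simp add: a_def)
  have "(\<Sum>p\<in>V \<times> V. a (fst p) * a (snd p) * (1 - M (fst p) (snd p))) =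
     (\<Sum>p\<in>V \<times> V. if p \<in> parcs graph \<inter> ?C \<times> ?C then 32 else 0)"
  proof (rule sum.cong[OF refl])
    fix p assume p: "p \<in> V \<times> V"
    obtain z w where zw: "p = (z, w)"
      by (cases p)
    show "a (fst p) * a (snd p) * (1 - M (fst p) (snd p)) =
        (if p \<in> parcs graph \<inter> ?C \<times> ?C then 32 else 0)"
      using M_vals[of z w] p by (auto simp: zw a arc_iff)
  qed
  also have "\<dots> = (\<Sum>p\<in>{p \<in> V \<times> V. p \<in> parcs graph \<inter> ?C \<times> ?C}. 32)"
    by (rule sum.inter_filter[symmetric]) (simp add: fin_V)
  also have "{p \<in> V \<times> V. p \<in> parcs graph \<inter> ?C \<times> ?C} = parcs graph \<inter> ?C \<times> ?C"
    using common_neighbours_sub by auto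
  finally have "32 * int (card (parcs graph \<inter> ?C \<times> ?C)) =
      (\<Sum>z\<in>V. \<Sum>w\<in>V. a z * a w * (1 - M z w))"
    by (simp add: sum.cartesian_product case_prod_beta)
  also have "\<dots> = (\<Sum>z\<in>V. a z) * (\<Sum>w\<in>V. a w) - (\<Sum>z\<in>V. \<Sum>w\<in>V. a z * a w * M z w)"
    by (simp add: sum_product sum_subtractf algebra_simps)
  finally show ?thesis
    using common_neighbours_sum[OF assms] common_neighbours_form[OF assms] by (simp add: a_def)
qed

lemma strongly_regular:
  "strongly_regular graph (card V - 1) (card V div 2) (card V div 4) (card V div 4)"
proof -
  have deg: "out_degree (with_proj graph) x = card V div 2" if x: "x \<in> V - {o\<^sub>V}" for x
  proof -
    have "out_arcs (with_proj graph) x = Pair x ` {z. (x, z) \<in> parcs graph}"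
      by (auto simp: out_arcs_def)
    then show ?thesis
      using degree[OF x] by (simp add: out_degree_def card_image inj_on_def)
  qed
  have cn: "card (common_neighbours graph x y) = card V div 4"
    if "x \<in> pverts graph" "y \<in> pverts graph" "x \<noteq> y" for x y
    using card_common_neighbours[of x y] that by (simp add: graph_def)
  have cV: "card (pverts graph) = card V - 1"
    using fin_V o_in by (simp add: graph_def)
  have "V - {o\<^sub>V} \<noteq> {}"
    using cV large by (intro notI) (simp add: graph_def)
  then obtain x where x: "x \<in> V - {o\<^sub>V}"
    by auto
  have "card {z. (x, z) \<in> parcs graph} > 0"
    using degree[OF x] large by linarith
  then have "{z. (x, z) \<in> parcs graph} \<noteq> {}"
    by (metis card.empty less_irrefl)
  then have ne: "parcs graph \<noteq> {}"
    by auto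
  have nc: "\<not> complete_digraph (card V - 1) (with_proj graph)"
  proof
    assume "complete_digraph (card V - 1) (with_proj graph)"
    then have "{z. (x, z) \<in> parcs graph} = V - {o\<^sub>V, x}"
      using x by (auto simp: complete_digraph_pair_def graph_def)
    moreover have "card {o\<^sub>V, x} = 2"
      using x by auto
    ultimately have "card {z. (x, z) \<in> parcs graph} = card V - 2"
      using x o_in by (simp add: card_Diff_subset)
    then show False
      using degree[OF x] large by linarith
  qed
  have "\<forall>x y. (x, y) \<in> parcs graph \<longrightarrow> x \<noteq> y"
    using pair_graph by (auto simp: pair_graph_iff irrefl_def)
  then show ?thesis
    using deg cn cV ne nc pair_graph unfolding strongly_regular_def by (auto simp: graph_def)
qed

lemma vertex_condition: "vertex_condition 4 graph"
proof -
  interpret srg graph "card V - 1" "card V div 2" "card V div 4" "card V div 4"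
    by unfold_locales (rule strongly_regular)
  let ?N = "int (card V)"
  show ?thesis
  proof (rule vertex_condition_four)
    fix x y assume xy: "x \<in> pverts graph" "y \<in> pverts graph" "x \<noteq> y"
    then have "M x y = (if (x, y) \<in> parcs graph then -1 else 1)"
      using M_vals[of x y] arc_iff[of x y] by (auto simp: graph_def)
    then have "32 * int (card (parcs graph \<inter> common_neighbours graph x y \<times> common_neighbours graph x y)) =
        ?N * ?N - 2 * ?N + 2 * ?N * (if (x, y) \<in> parcs graph then -1 else 1)"
      using card_common_arcs[of x y] xy by (simp add: graph_def)
    then show "card (parcs graph \<inter> common_neighbours graph x y \<times> common_neighbours graph x y) =
       (\<lambda>e. nat ((?N * ?N - 2 * ?N + 2 * ?N * (if e then -1 else 1)) div 32)) ((x, y) \<in> parcs graph)"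
      by (simp flip: \<open>32 * int _ = _\<close>)
  qed
qed

text \<open>This moves the construction from pairs of sets to indices that are natural numbers, the
  vertex type of the final graphs.\<close>

lemma reindex:
  assumes h: "bij_betw h W V" and o': "o' \<in> W" "h o' = o\<^sub>V"
  shows "quadratic_hadamard W o' (\<lambda>i j. M (h i) (h j))"
proof -
  have hV: "h i \<in> V" if "i \<in> W" for i
    using h that by (auto simp: bij_betw_def)
  have h_eq: "h i = h j \<longleftrightarrow> i = j" if "i \<in> W" "j \<in> W" for i j
    using h that by (auto simp: bij_betw_def inj_on_eq_iff)
  have cW: "card W = card V"
    using h by (rule bij_betw_same_card)
  have fW: "finite W"
    using bij_betw_finite[OF h] fin_V by simp
  have sum_h: "(\<Sum>i\<in>W. f (h i)) = (\<Sum>z\<in>V. f z)" for f :: "'a \<Rightarrow> int"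
    by (rule sum.reindex_bij_betw[OF h])
  have sum_hh: "(\<Sum>k\<in>W. \<Sum>l\<in>W. F (h k) (h l)) = (\<Sum>z\<in>V. \<Sum>w\<in>V. F z w)" for F :: "'a \<Rightarrow> 'a \<Rightarrow> int"
    using sum_h[of "\<lambda>z. \<Sum>w\<in>V. F z w"] by (simp add: sum_h)
  show ?thesis
  proof
    fix i j assume ij: "i \<in> W" "j \<in> W"
    show "(\<Sum>k\<in>W. M (h i) (h k) * M (h j) (h k)) = (if i = j then int (card W) else 0)"
      using sum_h[of "\<lambda>z. M (h i) z * M (h j) z"] M_orth[OF hV hV, OF ij] ij by (simp add: cW h_eq)
    show "(\<Sum>k\<in>W. \<Sum>l\<in>W. M (h i) (h k) * M (h j) (h k) * (M (h i) (h l) * M (h j) (h l)) * M (h k) (h l)) =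
        int (card W)"
      using M_quad[OF hV hV, OF ij]
        sum_hh[of "\<lambda>z w. (M (h i) z * M (h j) z) * (M (h i) w * M (h j) w) * M z w"]
      by (simp only: cW)
  qed (use fW cW o' hV M_sym M_vals M_diag M_o large in auto)
qed

end

section \<open>Twisted symplectic graphs\<close>

definition chi :: "nat set \<Rightarrow> nat set \<Rightarrow> int" where
  "chi a b = (- 1) ^ card (a \<inter> b)"

lemma chi_commute: "chi a b = chi b a"
  by (simp add: chi_def Int_commute)

lemma chi_empty [simp]: "chi a {} = 1" "chi {} a = 1"
  by (simp_all add: chi_def)

lemma chi_vals: "chi a b = 1 \<or> chi a b = -1"
  by (simp add: chi_def minus_one_power_iff)

lemma chi_square [simp]: "chi a b * chi a b = 1"
  using chi_vals[of a b] by auto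

lemma chi_singleton: "chi {j} b = (if j \<in> b then -1 else 1)"
  by (simp add: chi_def)

text \<open>Symmetric difference is vector addition, so this is multiplicativity of a character:
  elements of \<open>a\<close> lying in both \<open>b\<close> and \<open>c\<close> are counted twice
  and do not affect the sign.\<close>

lemma chi_sym_diff:
  assumes "finite a"
  shows "chi a b * chi a c = chi a (sym_diff b c)"
proof -
  have "card (a \<inter> b) + card (a \<inter> c) = card (a \<inter> b - c) + card (a \<inter> c - b) + 2 * card (a \<inter> b \<inter> c)"
    using assms card_Int_Diff[of "a \<inter> b" c] card_Int_Diff[of "a \<inter> c" b] by (simp add: Int_ac)
  also have "card (a \<inter> b - c) + card (a \<inter> c - b) = card ((a \<inter> b - c) \<union> (a \<inter> c - b))"
    using assms by (subst card_Un_disjoint) auto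
  also have "(a \<inter> b - c) \<union> (a \<inter> c - b) = a \<inter> sym_diff b c"
    by auto
  finally show ?thesis
    by (simp add: chi_def flip: power_add) (simp add: power_add power_mult)
qed

text \<open>If \<open>c\<close> contains some \<open>j\<close>, toggling \<open>j\<close> in
  \<open>a\<close> reverses the sign of every term, so the sum equals its own negative.\<close>

lemma sum_chi:
  assumes "finite D" "c \<subseteq> D"
  shows "(\<Sum>a\<in>Pow D. chi a c) = (if c = {} then 2 ^ card D else 0)"
proof (cases "c = {}")
  case True
  then show ?thesis
    using assms by (simp add: card_Pow)
next
  case False
  then obtain j where j: "j \<in> c"
    by auto
  have fc: "finite c"
    using assms finite_subset by auto
  have "chi (sym_diff a {j}) c = - chi a c" for a
    using chi_sym_diff[OF fc, of a "{j}"] j by (simp add: chi_commute[of c] chi_singleton)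
  then have "(\<Sum>a\<in>Pow D. chi a c) = (\<Sum>a\<in>Pow D. - chi a c)"
    by (intro sum.reindex_bij_witness[where i = "\<lambda>a. sym_diff a {j}" and j = "\<lambda>a. sym_diff a {j}"])
      (use j assms in auto)
  then show ?thesis
    using False by (simp add: sum_negf)
qed

lemma sum_chi_chi:
  assumes "finite D" "b \<subseteq> D" "c \<subseteq> D"
  shows "(\<Sum>a\<in>Pow D. chi a b * chi a c) = (if b = c then 2 ^ card D else 0)"
proof -
  have "(\<Sum>a\<in>Pow D. chi a b * chi a c) = (\<Sum>a\<in>Pow D. chi a (sym_diff b c))"
    using assms by (intro sum.cong) (auto simp: chi_sym_diff finite_subset)
  also have "\<dots> = (if sym_diff b c = {} then 2 ^ card D else 0)"
    by (rule sum_chi) (use assms in auto)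
  also have "sym_diff b c = {} \<longleftrightarrow> b = c"
    by auto
  finally show ?thesis .
qed

lemma sum_chi_chi_chi:
  assumes "finite D" "b \<subseteq> D" "c \<subseteq> D" "e \<subseteq> D"
  shows "(\<Sum>a\<in>Pow D. chi a b * chi a c * chi a e) = (if sym_diff b c = e then 2 ^ card D else 0)"
proof -
  have "(\<Sum>a\<in>Pow D. chi a b * chi a c * chi a e) = (\<Sum>a\<in>Pow D. chi a (sym_diff b c) * chi a e)"
    using assms by (intro sum.cong) (auto simp: chi_sym_diff finite_subset)
  also have "\<dots> = (if sym_diff b c = e then 2 ^ card D else 0)"
    by (rule sum_chi_chi) (use assms in auto)
  finally show ?thesis .
qed

lemma sum_indicator_square:
  assumes "finite P" "c \<in> P"
  shows "(\<Sum>b\<in>P. \<Sum>b'\<in>P. if b = c \<and> b' = c then f b b' else 0) = (f c c :: int)"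
proof -
  have "(\<Sum>b'\<in>P. if b = c \<and> b' = c then f b b' else 0) = (if b = c then f c c else 0)" for b
    using assms by (cases "b = c") simp_all
  then show ?thesis
    using assms by simp
qed

text \<open>
  Vectors over the field with two elements are subsets of \<open>D\<close>, and \<open>(-1)\<close> to the scalar product is
  \<^const>\<open>chi\<close>. For \<open>\<phi> = id\<close> the form is the symplectic one on \<open>Pow D \<times> Pow D\<close>; a general \<open>\<phi>\<close> twists
  the adjacencies between the Lagrangian \<open>Pow D \<times> {{}}\<close> and its complement.
\<close>

locale twisted_symplectic =
  fixes d :: nat and \<phi> :: "nat set \<Rightarrow> nat set"
  assumes d: "d \<ge> 2" and perm: "\<phi> permutes (Pow {..<d} - {{}})"
begin

abbreviation "D \<equiv> {..<d}"
abbreviation "V \<equiv> Pow D \<times> Pow D"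

text \<open>The second argument is only tested for being \<open>{}\<close>: a vector is twisted
  exactly when it is paired with a point of the Lagrangian. So \<open>form (s, {}) (a, b)\<close> is
  \<open>chi s (\<phi> b)\<close>, while two points outside the Lagrangian see the untwisted
  form.\<close>

definition \<theta> :: "nat set \<Rightarrow> nat set \<Rightarrow> nat set" where
  "\<theta> t b = (if b = {} then \<phi> t else t)"

fun form :: "nat set \<times> nat set \<Rightarrow> nat set \<times> nat set \<Rightarrow> int" where
  "form (s, t) (a, b) = chi s (\<theta> b t) * chi a (\<theta> t b)"

lemma \<phi>_empty [simp]: "\<phi> {} = {}"
  using perm by (simp add: permutes_def)

lemma \<phi>_bij: "bij_betw \<phi> (Pow D) (Pow D)"
  using permutes_imp_bij[OF permutes_subset[OF perm]] by auto

lemma \<phi>_eq_iff: "\<phi> s = \<phi> t \<longleftrightarrow> s = t"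
  using permutes_inj[OF perm] by (auto dest: injD)

lemma \<theta>_simps [simp]: "\<theta> {} b = {}" "\<theta> t {} = \<phi> t" "b \<noteq> {} \<Longrightarrow> \<theta> t b = t"
  by (simp_all add: \<theta>_def)

lemma \<theta>_eq_iff: "\<theta> s b = \<theta> t b \<longleftrightarrow> s = t"
  by (simp add: \<theta>_def \<phi>_eq_iff)

lemma \<theta>_bij: "bij_betw (\<lambda>t. \<theta> t b) (Pow D) (Pow D)"
  using \<phi>_bij by (cases "b = {}") (simp_all add: \<theta>_def bij_betw_def inj_on_def)

lemma \<theta>_sub: "t \<subseteq> D \<Longrightarrow> \<theta> t b \<subseteq> D"
  using \<theta>_bij[of b] by (auto simp: bij_betw_def)

lemma fin: "finite (Pow D)"
  by simp

lemma sum_V: "(\<Sum>z\<in>V. f z) = (\<Sum>a\<in>Pow D. \<Sum>b\<in>Pow D. f (a, b))"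
  by (simp add: sum.cartesian_product case_prod_beta)

text \<open>For a fixed second component \<open>b\<close> of \<open>z\<close>, the sum over the
  first component is a character sum, which forces \<open>t = t'\<close> because \<theta> is
  injective in its first argument. Then \<theta> merely permutes the values of \<open>b\<close>, and
  the remaining character sum forces \<open>s = s'\<close>.\<close>

lemma form_orth:
  assumes "x \<in> V" "y \<in> V"
  shows "(\<Sum>z\<in>V. form x z * form y z) = (if x = y then 2 ^ d * 2 ^ d else 0)"
proof -
  obtain s t where x: "x = (s, t)" by fastforce
  obtain s' t' where y: "y = (s', t')" by fastforce
  have sub: "s \<subseteq> D" "t \<subseteq> D" "s' \<subseteq> D" "t' \<subseteq> D"
    using assms x y by auto
  have "(\<Sum>z\<in>V. form x z * form y z) = (\<Sum>a\<in>Pow D. \<Sum>b\<in>Pow D. form x (a, b) * form y (a, b))"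
    by (rule sum_V)
  also have "\<dots> = (\<Sum>b\<in>Pow D. chi s (\<theta> b t) * chi s' (\<theta> b t') * (\<Sum>a\<in>Pow D. chi a (\<theta> t b) * chi a (\<theta> t' b)))"
    by (subst sum.swap) (simp add: x y sum_distrib_left mult_ac)
  also have "\<dots> = (\<Sum>b\<in>Pow D. chi s (\<theta> b t) * chi s' (\<theta> b t') * (if t = t' then 2 ^ d else 0))"
    using sub by (simp add: sum_chi_chi \<theta>_sub \<theta>_eq_iff)
  also have "\<dots> = (if x = y then 2 ^ d * 2 ^ d else 0)"
  proof (cases "t = t'")
    case True
    have "(\<Sum>b\<in>Pow D. chi s (\<theta> b t) * chi s' (\<theta> b t)) = (\<Sum>b\<in>Pow D. chi s b * chi s' b)"
      by (rule sum.reindex_bij_betw[OF \<theta>_bij])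
    also have "\<dots> = (if s = s' then 2 ^ d else 0)"
      using sum_chi_chi[of D s s'] sub by (simp add: chi_commute)
    finally show ?thesis
      using True by (simp add: x y flip: sum_distrib_right)
  qed (simp add: x y)
  finally show ?thesis .
qed

text \<open>Summing over the first components of \<open>z\<close> and \<open>w\<close> turns the
  characters into two equations for the second components \<open>b\<close> and \<open>b'\<close>.
  Their only solution is \<open>b = b' = c\<close>, and the sign of this single surviving term is a
  square.\<close>

lemma form_quad:
  assumes "x \<in> V" "y \<in> V"
  shows "(\<Sum>z\<in>V. \<Sum>w\<in>V. (form x z * form y z) * (form x w * form y w) * form z w) = 2 ^ d * 2 ^ d"
proof -
  obtain s t where x: "x = (s, t)" by fastforce
  obtain s' t' where y: "y = (s', t')" by fastforce
  have sub: "s \<subseteq> D" "t \<subseteq> D" "s' \<subseteq> D" "t' \<subseteq> D"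
    using assms x y by auto
  define c where "c = sym_diff t t'"
  define \<epsilon> where "\<epsilon> = (\<lambda>b. chi s (\<theta> b t) * chi s' (\<theta> b t'))"
  have c: "c \<in> Pow D"
    using sub by (auto simp: c_def)
  have \<epsilon>: "\<epsilon> b * \<epsilon> b = 1" for b
    using chi_vals[of s "\<theta> b t"] chi_vals[of s' "\<theta> b t'"] by (auto simp: \<epsilon>_def)
  \<comment> \<open>If both \<open>b\<close> and \<open>b'\<close> are nonempty, the equations say
    \<open>b' = c\<close> and \<open>b = c\<close>; if both are empty, they say
    \<open>t = t'\<close>. If exactly one is empty, one equation gives \<open>t = t'\<close>, and
    then the other makes the nonempty one empty.\<close>
  have collapse: "sym_diff (\<theta> t b) (\<theta> t' b) = \<theta> b' b \<and> sym_diff (\<theta> t b') (\<theta> t' b') = \<theta> b b' \<longleftrightarrow>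
      b = c \<and> b' = c" for b b'
  proof -
    have e: "sym_diff A B = {} \<longleftrightarrow> A = B" for A B :: "nat set"
      by auto
    have z: "\<phi> u = {} \<longleftrightarrow> u = {}" "{} = \<phi> u \<longleftrightarrow> u = {}" for u
      using \<phi>_eq_iff[of u "{}"] \<phi>_eq_iff[of "{}" u] by auto
    show ?thesis
      by (cases "b = {}"; cases "b' = {}") (auto simp: c_def e \<phi>_eq_iff z)
  qed
  have "(\<Sum>z\<in>V. \<Sum>w\<in>V. (form x z * form y z) * (form x w * form y w) * form z w) =
     (\<Sum>a\<in>Pow D. \<Sum>b\<in>Pow D. \<Sum>a'\<in>Pow D. \<Sum>b'\<in>Pow D.
        (form x (a, b) * form y (a, b)) * (form x (a', b') * form y (a', b')) * form (a, b) (a', b'))"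
    by (simp only: sum_V)
  \<comment> \<open>The first components \<open>a\<close> and \<open>a'\<close> occur only as
    arguments of characters, in separate factors, so their sums can be moved inwards and evaluated
    independently.\<close>
  also have "\<dots> = (\<Sum>b\<in>Pow D. \<Sum>a\<in>Pow D. \<Sum>b'\<in>Pow D. \<Sum>a'\<in>Pow D.
       (\<epsilon> b * \<epsilon> b') * (chi a (\<theta> t b) * chi a (\<theta> t' b) * chi a (\<theta> b' b)) *
        (chi a' (\<theta> t b') * chi a' (\<theta> t' b') * chi a' (\<theta> b b')))"
    by (rule trans[OF sum.swap], rule sum.cong[OF refl], rule sum.cong[OF refl],
        rule trans[OF sum.swap], rule sum.cong[OF refl], rule sum.cong[OF refl])
      (simp add: x y \<epsilon>_def mult_ac)
  also have "\<dots> = (\<Sum>b\<in>Pow D. \<Sum>b'\<in>Pow D. \<epsilon> b * \<epsilon> b' *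
       (\<Sum>a\<in>Pow D. chi a (\<theta> t b) * chi a (\<theta> t' b) * chi a (\<theta> b' b)) *
       (\<Sum>a'\<in>Pow D. chi a' (\<theta> t b') * chi a' (\<theta> t' b') * chi a' (\<theta> b b')))"
    by (rule sum.cong[OF refl], rule trans[OF sum.swap], rule sum.cong[OF refl])
      (simp only: mult.assoc sum_product, simp only: sum_distrib_left mult.assoc)
  also have "\<dots> = (\<Sum>b\<in>Pow D. \<Sum>b'\<in>Pow D. \<epsilon> b * \<epsilon> b' *
       (if sym_diff (\<theta> t b) (\<theta> t' b) = \<theta> b' b then 2 ^ d else 0) *
       (if sym_diff (\<theta> t b') (\<theta> t' b') = \<theta> b b' then 2 ^ d else 0))"
  proof (intro sum.cong refl, goal_cases)
    case (1 b b')
    then show ?case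
      using sub by (subst (1 2) sum_chi_chi_chi) (simp_all add: \<theta>_sub)
  qed
  also have "\<dots> = (\<Sum>b\<in>Pow D. \<Sum>b'\<in>Pow D. if b = c \<and> b' = c then \<epsilon> b * \<epsilon> b' * (2 ^ d * 2 ^ d) else 0)"
  proof (intro sum.cong refl)
    fix b b'
    show "\<epsilon> b * \<epsilon> b' *
       (if sym_diff (\<theta> t b) (\<theta> t' b) = \<theta> b' b then 2 ^ d else 0) *
       (if sym_diff (\<theta> t b') (\<theta> t' b') = \<theta> b b' then 2 ^ d else 0) =
      (if b = c \<and> b' = c then \<epsilon> b * \<epsilon> b' * (2 ^ d * 2 ^ d) else 0)"
      unfolding collapse[symmetric] by simp
  qed
  also have "\<dots> = 2 ^ d * 2 ^ d"
    using sum_indicator_square[OF fin c, of "\<lambda>b b'. \<epsilon> b * \<epsilon> b' * (2 ^ d * 2 ^ d)"] by (simp add: \<epsilon>)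
  finally show ?thesis .
qed

lemma card_V: "card V = 2 ^ d * 2 ^ d"
  by (simp add: card_cartesian_product card_Pow)

sublocale quadratic_hadamard V "({}, {})" form
proof
  have "(2::nat) ^ 2 \<le> 2 ^ d"
    using d by (intro power_increasing) auto
  then have "(4::nat) * 4 \<le> 2 ^ d * 2 ^ d"
    by (intro mult_mono) auto
  then show "4 < card V"
    unfolding card_V by linarith
  show "form x y = form y x" for x y
    by (cases x; cases y) simp
  show "form x y = 1 \<or> form x y = -1" for x y
  proof -
    obtain s t a b where "x = (s, t)" "y = (a, b)"
      by fastforce
    then show ?thesis
      using chi_vals[of s "\<theta> b t"] chi_vals[of a "\<theta> t b"] by auto
  qed
  show "form x x = 1" for x
    by (cases x) simp
  show "form ({}, {}) x = 1" for x
    by (cases x) simp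
  show "(\<Sum>z\<in>V. form x z * form y z) = (if x = y then int (card V) else 0)" if "x \<in> V" "y \<in> V" for x y
    using form_orth[OF that] by (simp only: card_V of_nat_mult of_nat_power of_nat_numeral)
  show "(\<Sum>z\<in>V. \<Sum>w\<in>V. (form x z * form y z) * (form x w * form y w) * form z w) = int (card V)"
    if "x \<in> V" "y \<in> V" for x y
    using form_quad[OF that] by (simp only: card_V of_nat_mult of_nat_power of_nat_numeral)
qed auto

end

section \<open>Counting isomorphism classes\<close>

lemma fact_add_ge: "fact m * (m + 1) ^ n \<le> (fact (m + n) :: nat)"
proof (induction n)
  case (Suc n)
  have "fact m * (m + 1) ^ Suc n \<le> fact (m + n) * (m + 1 + n)"
    using mult_mono[OF Suc, of "m + 1" "m + 1 + n"] by (simp add: mult_ac)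
  then show ?case
    by (simp add: mult_ac)
qed simp

text \<open>The threshold 7 is the first value where this holds from then on:
  \<open>56 \<le> 64\<close>, whereas \<open>d = 6\<close> would need
  \<open>48 \<le> 32\<close>.\<close>

lemma two_power_ge:
  assumes "d \<ge> 7"
  shows "8 * d \<le> 2 ^ (d - 1)"
  using assms
proof (induction d rule: nat_induct_at_least)
  case (Suc d)
  then have "(2 :: nat) ^ (Suc d - 1) = 2 * 2 ^ (d - 1)"
    by (simp flip: power_Suc)
  moreover have "8 * Suc d \<le> 2 * p" if "8 * d \<le> p" for p
    using that Suc.hyps by presburger
  ultimately show ?case
    using Suc.IH by (simp only:)
qed simp

text \<open>With \<open>?m = 2 ^ (d - 1)\<close>, the factorial of \<open>2 * ?m - 1\<close> is at
  least \<open>?m ^ ?m * fact (?m - 1)\<close>. The last factor pays for \<open>fact k\<close>,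
  since \<open>k < ?m\<close>; the power pays for \<open>2 ^ (6 * d * d)\<close>, since
  \<open>6 * d \<le> 8 * (d - 1)\<close> and \<open>8 * d \<le> ?m\<close>.\<close>

lemma fact_two_power_ge:
  fixes d k :: nat
  assumes d: "d \<ge> 7" and k: "k ^ 6 < 4 ^ (d + 1)"
  shows "(2 ^ d * 2 ^ d) ^ (3 * d) * fact k \<le> (fact (2 ^ d - 1) :: nat)"
proof -
  let ?m = "2 ^ (d - 1) :: nat"
  have two_d: "2 ^ d = 2 * ?m"
    using d by (simp flip: power_Suc)
  have "k < ?m"
  proof (rule ccontr)
    assume "\<not> k < ?m"
    then have "?m ^ 6 \<le> k ^ 6"
      by (intro power_mono) auto
    moreover have "?m ^ 6 = 2 ^ ((d - 1) * 6)"
      by (simp only: power_mult)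
    moreover have "(2 :: nat) ^ (2 * (d + 1)) \<le> 2 ^ ((d - 1) * 6)"
      using d by (intro power_increasing) auto
    moreover have "(4 :: nat) ^ (d + 1) = 2 ^ (2 * (d + 1))"
      by (simp only: power_mult) simp
    ultimately show False
      using k by linarith
  qed
  then have k': "fact k \<le> (fact (?m - 1) :: nat)"
    by (intro fact_mono_nat) auto
  have "6 * d * d \<le> ((d - 1) * 8) * d"
    using d by (intro mult_right_mono) auto
  then have "6 * d * d \<le> (d - 1) * (8 * d)"
    by (simp only: mult.assoc)
  also have "\<dots> \<le> (d - 1) * ?m"
    using two_power_ge[OF d] by (rule mult_left_mono) simp
  finally have "(2 :: nat) ^ (6 * d * d) \<le> ?m ^ ?m"
    by (simp flip: power_mult)
  moreover have "(2 ^ d * 2 ^ d :: nat) ^ (3 * d) = 2 ^ (6 * d * d)"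
    by (simp add: power_mult_distrib flip: power_mult power_add)
  ultimately have "(2 ^ d * 2 ^ d) ^ (3 * d) * fact k \<le> ?m ^ ?m * (fact (?m - 1) :: nat)"
    using k' by (simp only: mult_le_mono)
  also have "\<dots> \<le> fact (2 ^ d - 1)"
    using fact_add_ge[of "?m - 1" ?m] by (simp add: two_d mult_ac mult_2)
  finally show ?thesis .
qed

text \<open>Greedy choice: keep some \<open>a\<close>, discard the at most \<open>K\<close> elements
  related to it, and continue with the rest.\<close>

lemma exists_large_independent:
  assumes "finite A"
    and "\<And>a. a \<in> A \<Longrightarrow> card {b \<in> A. R b a} \<le> K"
    and "\<And>a. a \<in> A \<Longrightarrow> R a a"
    and "\<And>a b. a \<in> A \<Longrightarrow> b \<in> A \<Longrightarrow> R a b \<Longrightarrow> R b a"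
  shows "\<exists>B\<subseteq>A. pairwise (\<lambda>a b. \<not> R a b) B \<and> card A \<le> K * card B"
  using assms
proof (induction A rule: finite_psubset_induct)
  case (psubset A)
  show ?case
  proof (cases "A = {}")
    case False
    then obtain a where a: "a \<in> A"
      by auto
    define A' where "A' = {b \<in> A. \<not> R b a}"
    have sub: "A' \<subset> A"
      using a psubset.prems(2)[OF a] by (auto simp: A'_def)
    have nbrs: "card {b \<in> A'. R b c} \<le> K" if "c \<in> A'" for c
    proof -
      have "card {b \<in> A'. R b c} \<le> card {b \<in> A. R b c}"
        using psubset.hyps(1) by (intro card_mono) (auto simp: A'_def)
      also have "\<dots> \<le> K"
        using psubset.prems(1)[of c] that by (simp add: A'_def)
      finally show ?thesis .
    qed
    have "\<exists>B\<subseteq>A'. pairwise (\<lambda>a b. \<not> R a b) B \<and> card A' \<le> K * card B"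
      by (rule psubset.IH[OF sub nbrs]) (use sub psubset.prems(2,3) in blast)+
    then obtain B where B: "B \<subseteq> A'" "pairwise (\<lambda>a b. \<not> R a b) B" "card A' \<le> K * card B"
      by blast
    have "finite B"
      using B(1) psubset.hyps(1) by (auto simp: A'_def intro: finite_subset)
    moreover have "a \<notin> B"
      using B(1) psubset.prems(2)[OF a] by (auto simp: A'_def)
    moreover have "card A \<le> card A' + card {b \<in> A. R b a}"
    proof -
      have "A = A' \<union> {b \<in> A. R b a}"
        by (auto simp: A'_def)
      then show ?thesis
        using card_Un_le by metis
    qed
    ultimately have "card A \<le> K * card (insert a B)"
      using B(3) psubset.prems(1)[OF a] by simp
    moreover have "pairwise (\<lambda>a b. \<not> R a b) (insert a B)"
      unfolding pairwise_insert using B(1,2) psubset.prems(3)[OF a] sub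
      by (auto simp: A'_def)
    moreover have "insert a B \<subseteq> A"
      using a B(1) by (auto simp: A'_def)
    ultimately show ?thesis
      by blast
  qed auto
qed

text \<open>At a point \<open>(s, t)\<close> with \<open>t\<close> nonempty, the first family reads
  off the coordinates of \<open>s\<close>, the second those of \<open>t\<close> once
  \<open>s = {}\<close> is known, and the third those of the twisted \<open>t\<close>. The component
  \<open>{0}\<close> serves as a nonempty set, against which \<open>t\<close> is not
  twisted.\<close>

definition base_points :: "nat \<Rightarrow> (nat set \<times> nat set) set" where
  "base_points d = (\<lambda>j. ({}, {j})) ` {..<d} \<union> (\<lambda>j. ({j}, {0})) ` {..<d} \<union> (\<lambda>j. ({j}, {})) ` {..<d}"

lemma card_base_points: "card (base_points d) \<le> 3 * d"
proof -
  have "card (base_points d) \<le> card ((\<lambda>j. ({} :: nat set, {j})) ` {..<d}) +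
      card ((\<lambda>j. ({j}, {0 :: nat})) ` {..<d}) + card ((\<lambda>j. ({j}, {} :: nat set)) ` {..<d})"
    unfolding base_points_def by (meson add_mono card_Un_le le_refl le_trans)
  also have "\<dots> \<le> card {..<d} + card {..<d} + card {..<d}"
    by (intro add_mono card_image_le) auto
  finally show ?thesis
    by simp
qed

lemma chi_eq_imp_eq:
  assumes "b \<subseteq> {..<d}" "c \<subseteq> {..<d}" "\<And>j. j < d \<Longrightarrow> chi {j} b = chi {j} c"
  shows "b = c"
proof (rule set_eqI)
  fix j
  show "j \<in> b \<longleftrightarrow> j \<in> c"
    using assms(1,2) assms(3)[of j] by (cases "j < d") (auto simp: chi_singleton split: if_splits)
qed

text \<open>
  The adjacencies to the base points are coordinates: they identify the vertices \<open>({}, t)\<close>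
  intrinsically and then read off \<open>\<phi> t\<close>.
\<close>

lemma twist_eqI:
  assumes \<phi>: "twisted_symplectic d \<phi>" and \<phi>': "twisted_symplectic d \<phi>'"
    and f: "\<And>p. p \<in> Pow {..<d} \<times> Pow {..<d} - {({}, {})} \<Longrightarrow> f p \<in> Pow {..<d} \<times> Pow {..<d} - {({}, {})}"
    and pres: "\<And>p x. p \<in> Pow {..<d} \<times> Pow {..<d} - {({}, {})} \<Longrightarrow> x \<in> base_points d \<Longrightarrow>
        twisted_symplectic.form \<phi>' (f p) x = twisted_symplectic.form \<phi> p x"
  shows "\<phi> = \<phi>'"
proof
  interpret A: twisted_symplectic d \<phi> by fact
  interpret B: twisted_symplectic d \<phi>' by fact
  fix t
  show "\<phi> t = \<phi>' t"
  proof (cases "t \<in> Pow {..<d} - {{}}")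
    case True
    then have p: "({}, t) \<in> Pow {..<d} \<times> Pow {..<d} - {({}, {})}"
      by auto
    obtain s' t' where q: "f ({}, t) = (s', t')"
      by fastforce
    have sub: "s' \<subseteq> {..<d}" "t' \<subseteq> {..<d}" "t \<subseteq> {..<d}" "t \<noteq> {}"
      using f[OF p] q True by auto
    have eq: "B.form (s', t') x = A.form ({}, t) x" if "x \<in> base_points d" for x
      using pres[OF p that] q by simp
    have "\<phi>' t' = \<phi> t"
    proof (rule chi_eq_imp_eq)
      show "\<phi>' t' \<subseteq> {..<d}" "\<phi> t \<subseteq> {..<d}"
        using B.\<theta>_sub[of t' "{}"] A.\<theta>_sub[of t "{}"] sub by simp_all
      show "chi {j} (\<phi>' t') = chi {j} (\<phi> t)" if "j < d" for j
        using eq[of "({j}, {})"] that by (simp add: base_points_def)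
    qed
    moreover have "\<phi> t \<noteq> {}"
      using A.\<phi>_eq_iff[of t "{}"] sub by simp
    \<comment> \<open>This has to precede the determination of \<open>s'\<close>: for empty
      \<open>t'\<close> the points \<open>({}, {j})\<close> would be seen through the twist.\<close>
    ultimately have t': "t' \<noteq> {}"
      by auto
    have s': "s' = {}"
    proof (rule chi_eq_imp_eq)
      show "chi {j} s' = chi {j} {}" if "j < d" for j
        using eq[of "({}, {j})"] that t' by (simp add: base_points_def chi_commute)
    qed (use sub in auto)
    have "t' = t"
    proof (rule chi_eq_imp_eq)
      show "chi {j} t' = chi {j} t" if "j < d" for j
        using eq[of "({j}, {0})"] that by (simp add: base_points_def s')
    qed (use sub in auto)
    then show ?thesis
      using \<open>\<phi>' t' = \<phi> t\<close> by simp
  next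
    case False
    then show ?thesis
      using A.perm B.perm by (simp add: permutes_def)
  qed
qed

text \<open>All permutations of the nonzero vectors give graphs on one vertex set. Each isomorphism
  class contains the graphs of at most \<open>(2 ^ d * 2 ^ d) ^ (3 * d)\<close> permutations, so a
  greedy selection yields the stated number of representatives.\<close>

lemma many_twisted_graphs:
  assumes d: "d \<ge> 2"
  shows "\<exists>S :: nat pair_pre_digraph set. finite S \<and>
    fact (2 ^ d - 1) \<le> (2 ^ d * 2 ^ d) ^ (3 * d) * card S \<and>
    (\<forall>G\<in>S. (\<exists>k l m. strongly_regular G (2 ^ d * 2 ^ d - 1) k l m) \<and> vertex_condition 4 G) \<and>
    pairwise (\<lambda>G H. \<not> digraph_iso (with_proj G) (with_proj H)) S"
proof -
  define N :: nat where "N = 2 ^ d * 2 ^ d"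
  define V where "V = Pow {..<d} \<times> Pow {..<d}"
  define P where "P = Pow {..<d} - {{}}"
  define \<Phi> where "\<Phi> = {\<phi>. \<phi> permutes P}"
  have finP: "finite P" and cP: "card P = 2 ^ d - 1"
    by (simp_all add: P_def card_Pow)
  have fin\<Phi>: "finite \<Phi>" and c\<Phi>: "card \<Phi> = fact (2 ^ d - 1)"
    using finite_permutations[OF finP] card_permutations[OF cP finP] by (simp_all add: \<Phi>_def)
  have tw: "twisted_symplectic d \<phi>" if "\<phi> \<in> \<Phi>" for \<phi>
    using that d by unfold_locales (simp_all add: \<Phi>_def P_def)
  have V: "finite V" "card V = N"
    by (simp_all add: V_def N_def card_cartesian_product card_Pow)
  then obtain h where h: "bij_betw h {0..<N} V"
    using ex_bij_betw_nat_finite by blast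
  define W where "W = {0..<N}"
  have hW: "bij_betw h W V"
    using h by (simp add: W_def)
  have "({}, {}) \<in> V"
    by (simp add: V_def)
  then obtain o' where o': "o' \<in> W" "h o' = ({}, {})"
    using hW by (auto simp: bij_betw_def)
  define M where "M = (\<lambda>\<phi> i j. twisted_symplectic.form \<phi> (h i) (h j))"
  define \<Gamma> where "\<Gamma> = (\<lambda>\<phi>. quadratic_hadamard.graph W o' (M \<phi>))"
  have qh: "quadratic_hadamard W o' (M \<phi>)" if "\<phi> \<in> \<Phi>" for \<phi>
  proof -
    interpret twisted_symplectic d \<phi> by (rule tw[OF that])
    show ?thesis
      using reindex[OF _ o'(1), of h] o'(2) hW by (simp add: M_def V_def)
  qed
  have \<Gamma>: "\<exists>k l m. strongly_regular (\<Gamma> \<phi>) (N - 1) k l m" "vertex_condition 4 (\<Gamma> \<phi>)"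
    "pair_graph (\<Gamma> \<phi>)" "pverts (\<Gamma> \<phi>) = W - {o'}"
    "\<And>i j. i \<in> W \<Longrightarrow> j \<in> W \<Longrightarrow> (i, j) \<in> parcs (\<Gamma> \<phi>) \<longleftrightarrow> M \<phi> i j = -1"
    "\<And>i j. i \<in> W \<Longrightarrow> j \<in> W \<Longrightarrow> M \<phi> i j = 1 \<or> M \<phi> i j = -1"
    if "\<phi> \<in> \<Phi>" for \<phi>
  proof -
    interpret quadratic_hadamard W o' "M \<phi>" by (rule qh[OF that])
    show "\<exists>k l m. strongly_regular (\<Gamma> \<phi>) (N - 1) k l m"
      using strongly_regular unfolding \<Gamma>_def by (auto simp: W_def)
    show "vertex_condition 4 (\<Gamma> \<phi>)" "pair_graph (\<Gamma> \<phi>)" "pverts (\<Gamma> \<phi>) = W - {o'}"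
      using vertex_condition pair_graph by (simp_all add: \<Gamma>_def graph_def)
    show "(i, j) \<in> parcs (\<Gamma> \<phi>) \<longleftrightarrow> M \<phi> i j = -1" "M \<phi> i j = 1 \<or> M \<phi> i j = -1"
      if "i \<in> W" "j \<in> W" for i j
      using arc_iff[OF that] M_vals[OF that] by (simp_all add: \<Gamma>_def)
  qed
  define R where "R = (\<lambda>\<phi> \<psi>. digraph_iso (with_proj (\<Gamma> \<phi>)) (with_proj (\<Gamma> \<psi>)))"
  have wf: "wf_digraph (with_proj (\<Gamma> \<phi>))" if "\<phi> \<in> \<Phi>" for \<phi>
    using \<Gamma>(3)[OF that] by (auto simp: wf_digraph_def pair_graph_iff)
  define X where "X = {i \<in> W. h i \<in> base_points d}"
  have base_sub: "base_points d \<subseteq> V - {({}, {})}"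
    using d by (auto simp: base_points_def V_def)
  have finX: "finite X"
    by (simp add: X_def W_def)
  have cX: "card X \<le> 3 * d"
  proof -
    have "card X \<le> card (base_points d)"
      by (rule card_inj_on_le[of h]) (use hW in \<open>auto simp: X_def bij_betw_def inj_on_def base_points_def\<close>)
    then show ?thesis
      using card_base_points[of d] by linarith
  qed
  have XW: "X \<subseteq> W - {o'}"
    using base_sub o' by (auto simp: X_def)
  have class_size: "card {\<phi> \<in> \<Phi>. R \<phi> \<psi>} \<le> N ^ (3 * d)" if \<psi>: "\<psi> \<in> \<Phi>" for \<psi>
  proof -
    define Q where "Q = (\<lambda>\<phi> g. bij_betw g (W - {o'}) (W - {o'}) \<and>
        (\<forall>i\<in>W - {o'}. \<forall>j\<in>W - {o'}. M \<psi> (g i) (g j) = M \<phi> i j))"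
    have "\<exists>g. Q \<phi> g" if \<phi>: "\<phi> \<in> {\<phi> \<in> \<Phi>. R \<phi> \<psi>}" for \<phi>
    proof -
      have \<phi>': "\<phi> \<in> \<Phi>" "digraph_iso (with_proj (\<Gamma> \<phi>)) (with_proj (\<Gamma> \<psi>))"
        using \<phi> by (simp_all add: R_def)
      obtain g where g: "bij_betw g (pverts (\<Gamma> \<phi>)) (pverts (\<Gamma> \<psi>))"
        and arcs: "\<And>u v. u \<in> pverts (\<Gamma> \<phi>) \<Longrightarrow> v \<in> pverts (\<Gamma> \<phi>) \<Longrightarrow>
            (g u, g v) \<in> parcs (\<Gamma> \<psi>) \<longleftrightarrow> (u, v) \<in> parcs (\<Gamma> \<phi>)"
        using digraph_iso_with_projD[OF \<Gamma>(3)[OF \<phi>'(1)] \<phi>'(2)] by blast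
      have gb: "bij_betw g (W - {o'}) (W - {o'})"
        using g \<Gamma>(4)[OF \<phi>'(1)] \<Gamma>(4)[OF \<psi>] by simp
      moreover have "M \<psi> (g i) (g j) = M \<phi> i j" if "i \<in> W - {o'}" "j \<in> W - {o'}" for i j
      proof -
        have W: "g i \<in> W" "g j \<in> W" "i \<in> W" "j \<in> W"
          using bij_betwE[OF gb] that by blast+
        have "M \<psi> (g i) (g j) = -1 \<longleftrightarrow> M \<phi> i j = -1"
          using arcs[of i j] that W by (simp add: \<Gamma>(4,5)[OF \<phi>'(1)] \<Gamma>(5)[OF \<psi>])
        then show ?thesis
          using \<Gamma>(6)[OF \<phi>'(1) W(3,4)] \<Gamma>(6)[OF \<psi> W(1,2)] by linarith
      qed
      ultimately show ?thesis
        unfolding Q_def by blast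
    qed
    then obtain g where "\<forall>\<phi>\<in>{\<phi> \<in> \<Phi>. R \<phi> \<psi>}. Q \<phi> (g \<phi>)"
      using bchoice[of "{\<phi> \<in> \<Phi>. R \<phi> \<psi>}" Q] by blast
    then have g: "bij_betw (g \<phi>) (W - {o'}) (W - {o'})"
      and gM: "i \<in> W - {o'} \<Longrightarrow> j \<in> W - {o'} \<Longrightarrow> M \<psi> (g \<phi> i) (g \<phi> j) = M \<phi> i j"
      if "\<phi> \<in> {\<phi> \<in> \<Phi>. R \<phi> \<psi>}" for \<phi> i j
      using that unfolding Q_def by blast+
    \<comment> \<open>The class of \<psi> is bounded by choosing an isomorphism onto its graph for
      every member and recording only the images of the base points.\<close>
    have "inj_on (\<lambda>\<phi>. restrict (g \<phi>) X) {\<phi> \<in> \<Phi>. R \<phi> \<psi>}"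
    proof (rule inj_onI)
      fix \<phi> \<phi>' assume \<phi>: "\<phi> \<in> {\<phi> \<in> \<Phi>. R \<phi> \<psi>}" and \<phi>': "\<phi>' \<in> {\<phi> \<in> \<Phi>. R \<phi> \<psi>}"
        and eq: "restrict (g \<phi>) X = restrict (g \<phi>') X"
      \<comment> \<open>This composes one chosen isomorphism with the inverse of the other. Since
        both agree on \<open>X\<close>, the resulting isomorphism between the two graphs preserves
        adjacency to each base point, and \<open>twist_eqI\<close> applies.\<close>
      define e where "e = (\<lambda>i. inv_into (W - {o'}) (g \<phi>') (g \<phi> i))"
      have e: "e i \<in> W - {o'}" "g \<phi>' (e i) = g \<phi> i" if "i \<in> W - {o'}" for i
      proof -
        have "g \<phi> i \<in> g \<phi>' ` (W - {o'})"
          using g[OF \<phi>] g[OF \<phi>'] that by (auto simp: bij_betw_def)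
        then show "e i \<in> W - {o'}" "g \<phi>' (e i) = g \<phi> i"
          unfolding e_def by (rule inv_into_into f_inv_into_f)+
      qed
      define u where "u = inv_into W h"
      have u: "u p \<in> W - {o'}" "h (u p) = p" if "p \<in> V - {({}, {})}" for p
      proof -
        have "p \<in> h ` W"
          using that hW by (simp add: bij_betw_def)
        then have "u p \<in> W" "h (u p) = p"
          unfolding u_def by (simp_all add: inv_into_into f_inv_into_f)
        then show "u p \<in> W - {o'}" "h (u p) = p"
          using that o' by auto
      qed
      show "\<phi> = \<phi>'"
      proof -
        have tws: "twisted_symplectic d \<phi>" "twisted_symplectic d \<phi>'"
          using tw \<phi> \<phi>' by auto
        have maps: "h (e (u p)) \<in> V - {({}, {})}" if "p \<in> V - {({}, {})}" for p
        proof -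
          have "e (u p) \<in> W - {o'}"
            using e(1) u(1) that by blast
          then show ?thesis
            using hW o' by (auto simp: bij_betw_def inj_on_def)
        qed
        have pres: "twisted_symplectic.form \<phi>' (h (e (u p))) x = twisted_symplectic.form \<phi> p x"
          if p: "p \<in> V - {({}, {})}" and x: "x \<in> base_points d" for p x
        proof -
          have x': "x \<in> V - {({}, {})}"
            using base_sub x by blast
          have uX: "u x \<in> X"
            using u[OF x'] x by (simp add: X_def)
          then have gx: "g \<phi> (u x) = g \<phi>' (u x)"
            using eq by (metis restrict_apply')
          have "M \<phi>' (e (u p)) (u x) = M \<psi> (g \<phi>' (e (u p))) (g \<phi>' (u x))"
            using gM[OF \<phi>' e(1)[OF u(1)[OF p]] u(1)[OF x']] by simp
          also have "\<dots> = M \<psi> (g \<phi> (u p)) (g \<phi> (u x))"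
            using e(2)[OF u(1)[OF p]] gx by simp
          also have "\<dots> = M \<phi> (u p) (u x)"
            by (rule gM[OF \<phi> u(1)[OF p] u(1)[OF x']])
          finally show ?thesis
            by (simp add: M_def u(2)[OF p] u(2)[OF x'])
        qed
        show ?thesis
          by (rule twist_eqI[OF tws, where f = "\<lambda>p. h (e (u p))", folded V_def]) (fact maps pres)+
      qed
    qed
    moreover have "(\<lambda>\<phi>. restrict (g \<phi>) X) ` {\<phi> \<in> \<Phi>. R \<phi> \<psi>} \<subseteq> X \<rightarrow>\<^sub>E W"
    proof (rule image_subsetI)
      fix \<phi> assume \<phi>: "\<phi> \<in> {\<phi> \<in> \<Phi>. R \<phi> \<psi>}"
      have "\<forall>i\<in>X. g \<phi> i \<in> W"
        using bij_betwE[OF g[OF \<phi>]] XW by blast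
      then show "restrict (g \<phi>) X \<in> X \<rightarrow>\<^sub>E W"
        by (simp add: restrict_PiE_iff)
    qed
    moreover have "finite (X \<rightarrow>\<^sub>E W)"
      using finX by (simp add: finite_PiE W_def)
    ultimately have "card {\<phi> \<in> \<Phi>. R \<phi> \<psi>} \<le> card (X \<rightarrow>\<^sub>E W)"
      by (rule card_inj_on_le)
    also have "\<dots> = N ^ card X"
      by (simp add: card_funcsetE[OF finX] W_def)
    also have "\<dots> \<le> N ^ (3 * d)"
      using cX by (intro power_increasing) (simp_all add: N_def)
    finally show ?thesis .
  qed
  have "\<exists>B\<subseteq>\<Phi>. pairwise (\<lambda>a b. \<not> R a b) B \<and> card \<Phi> \<le> N ^ (3 * d) * card B"
  proof (rule exists_large_independent[OF fin\<Phi> class_size])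
    show "R \<phi> \<phi>" if "\<phi> \<in> \<Phi>" for \<phi>
      using wf[OF that] by (simp add: R_def digraph_iso_refl)
    show "R \<psi> \<phi>" if "\<phi> \<in> \<Phi>" "\<psi> \<in> \<Phi>" "R \<phi> \<psi>" for \<phi> \<psi>
      using wf[OF that(1)] that(3) unfolding R_def by (rule digraph_iso_swap)
  qed
  then obtain B where B: "B \<subseteq> \<Phi>" "pairwise (\<lambda>a b. \<not> R a b) B" "card \<Phi> \<le> N ^ (3 * d) * card B"
    by blast
  have "inj_on \<Gamma> B"
  proof (rule inj_onI, rule ccontr)
    fix \<phi> \<psi> assume \<phi>\<psi>: "\<phi> \<in> B" "\<psi> \<in> B" "\<Gamma> \<phi> = \<Gamma> \<psi>" "\<phi> \<noteq> \<psi>"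
    then have "R \<phi> \<psi>"
      using wf[of \<psi>] B(1) by (auto simp: R_def digraph_iso_refl)
    then show False
      using B(2) \<phi>\<psi> by (auto simp: pairwise_def)
  qed
  then have "card (\<Gamma> ` B) = card B"
    by (rule card_image)
  show ?thesis
  proof (intro exI[of _ "\<Gamma> ` B"] conjI)
    show "finite (\<Gamma> ` B)"
      using B(1) fin\<Phi> finite_subset by blast
    show "fact (2 ^ d - 1) \<le> (2 ^ d * 2 ^ d) ^ (3 * d) * card (\<Gamma> ` B)"
      using B(3) c\<Phi> \<open>card (\<Gamma> ` B) = card B\<close> by (simp add: N_def)
    show "\<forall>G\<in>\<Gamma> ` B. (\<exists>k l m. strongly_regular G (2 ^ d * 2 ^ d - 1) k l m) \<and> vertex_condition 4 G"
      using B(1) \<Gamma>(1,2) unfolding N_def by blast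
    show "pairwise (\<lambda>G H. \<not> digraph_iso (with_proj G) (with_proj H)) (\<Gamma> ` B)"
    proof (rule pairwiseI)
      fix G H assume "G \<in> \<Gamma> ` B" "H \<in> \<Gamma> ` B" "G \<noteq> H"
      then obtain \<phi> \<psi> where "\<phi> \<in> B" "\<psi> \<in> B" "\<phi> \<noteq> \<psi>" "G = \<Gamma> \<phi>" "H = \<Gamma> \<psi>"
        by blast
      then show "\<not> digraph_iso (with_proj G) (with_proj H)"
        using B(2) by (simp add: pairwise_def R_def)
    qed
  qed
qed

section \<open>Choosing the family according to the size of \<open>v\<close>\<close>

theorem theorem1p1:
  fixes v :: nat
  assumes "v \<ge> 4"
  shows "\<exists>S :: nat pair_pre_digraph set.
    finite S \<and> card S \<ge> fact (nat \<lfloor>real v powr (1 / 6)\<rfloor>) \<and>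
    (\<forall>G \<in> S. (\<exists>n k l m. n \<le> v \<and> strongly_regular G n k l m) \<and> vertex_condition 4 G) \<and>
    pairwise (\<lambda>G H. \<not> digraph_iso (with_proj G) (with_proj H)) S"
proof -
  define k where "k = nat \<lfloor>real v powr (1 / 6)\<rfloor>"
  have "real k \<le> real v powr (1 / 6)"
    by (simp add: k_def)
  then have "real k ^ 6 \<le> (real v powr (1 / 6)) ^ 6"
    by (intro power_mono) auto
  also have "\<dots> = real v"
    using assms by (simp add: powr_powr flip: powr_realpow)
  finally have k: "k ^ 6 \<le> v"
    by (metis of_nat_le_iff of_nat_power)
  show ?thesis
    unfolding k_def[symmetric]
  \<comment> \<open>Matchings suffice up to 8, as \<open>fact 8 = 40320\<close> is below
    \<open>8 ^ 6 div 2 - 1 = 131071\<close>. At \<open>v = 9 ^ 6\<close> they fail: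
    \<open>fact 9 = 362880\<close> exceeds \<open>9 ^ 6 div 2 - 1 = 265719\<close>.\<close>
  proof (cases "k \<le> 8")
    case True
    then have "k = 0 \<or> k = 1 \<or> k = 2 \<or> k = 3 \<or> k = 4 \<or> k = 5 \<or> k = 6 \<or> k = 7 \<or> k = 8"
      by auto
    then have "fact k \<le> v div 2 - 1"
      using k assms by (elim disjE) (simp_all add: fact_numeral)
    then show "\<exists>S :: nat pair_pre_digraph set. finite S \<and> card S \<ge> fact k \<and>
      (\<forall>G \<in> S. (\<exists>n k l m. n \<le> v \<and> strongly_regular G n k l m) \<and> vertex_condition 4 G) \<and>
      pairwise (\<lambda>G H. \<not> digraph_iso (with_proj G) (with_proj H)) S"
      using many_matching_graphs[of v] by (intro exI[of _ "matching_graph ` {2..v div 2}"]) simp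
  next
    case False
    then have "9 ^ 6 \<le> k ^ 6"
      by (intro power_mono) auto
    with k have v: "(9 :: nat) ^ 6 \<le> v"
      by linarith
    \<comment> \<open>The twisted graphs have \<open>4 ^ d - 1\<close> vertices, hence
      \<open>v + 1\<close>. Taking \<open>d\<close> as large as possible also gives
      \<open>k ^ 6 < 4 ^ (d + 1)\<close>, as the factorial estimate requires.\<close>
    obtain d where d: "4 ^ d \<le> v + 1" "v + 1 < 4 ^ (d + 1)"
      using ex_power_ivl1[of 4 "v + 1"] by auto
    have "d \<ge> 7"
    proof (rule ccontr)
      assume "\<not> d \<ge> 7"
      then have "(4 :: nat) ^ (d + 1) \<le> 4 ^ 7"
        by (intro power_increasing) auto
      then show False
        using d v by simp
    qed
    obtain S :: "nat pair_pre_digraph set" where S: "finite S"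
      "fact (2 ^ d - 1) \<le> (2 ^ d * 2 ^ d) ^ (3 * d) * card S"
      "\<forall>G\<in>S. (\<exists>k l m. strongly_regular G (2 ^ d * 2 ^ d - 1) k l m) \<and> vertex_condition 4 G"
      "pairwise (\<lambda>G H. \<not> digraph_iso (with_proj G) (with_proj H)) S"
      using many_twisted_graphs[of d] \<open>d \<ge> 7\<close> by auto
    have "(2 ^ d * 2 ^ d) ^ (3 * d) * fact k \<le> (2 ^ d * 2 ^ d) ^ (3 * d) * card S"
      using fact_two_power_ge[of d k] \<open>d \<ge> 7\<close> d k S(2) by linarith
    then have "fact k \<le> card S"
      by simp
    moreover have "(2 :: nat) ^ d * 2 ^ d - 1 \<le> v"
      using d(1) by (simp flip: power_mult_distrib)
    ultimately show "\<exists>S :: nat pair_pre_digraph set. finite S \<and> card S \<ge> fact k \<and>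
      (\<forall>G \<in> S. (\<exists>n k l m. n \<le> v \<and> strongly_regular G n k l m) \<and> vertex_condition 4 G) \<and>
      pairwise (\<lambda>G H. \<not> digraph_iso (with_proj G) (with_proj H)) S"
      using S by (intro exI[of _ S]) blast
  qed
qed

end
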